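(* For $n$ bidders and $m$ items, the class of subadditive valuations is strongly $\alpha(\cdot)$-inapproximable in $2^{\Omega(\sqrt m-n^2\log m)}$ communication, where $$\alpha(t)=2-\mathbb{I}[t=1]-O\!\left(\frac{\log n}{\log m}\right),\qquad t\in[n].$$
   Context: Items are $M=[m]$, bidders are $[n]$. A valuation is a monotone function $v:2^M\to\mathbb{R}_{\ge0}$; it is subadditive if $v(S\cup T)\le v(S)+v(T)$ for all $S,T\subseteq M$. An allocation is an $n$-tuple $(A_1,\dots,A_n)$ of pairwise disjoint subsets of $M$, its welfare under $f_1,\dots,f_n$ is $\sum_i f_i(A_i)$, and the welfare of an instance is the maximum welfare of an allocation. An allocation is $t$-scarce if all but at most $t$ bidders are allocated $\emptyset$. For a valuation class $\mathcal{V}$ and $\alpha:[n]\to\mathbb{R}_{>0}$, the problem $(\mathcal{V},\alpha(\cdot))$-GapWelfare is the following $n$-player communication problem (number-in-hand blackboard model, randomized protocols): player $i$ receives a valuation $f_i\in\mathcal{V}$ over the items; the players must output $1$ if the welfare of $f_1,\dots,f_n$ is $n$; must output $0$ if for all $t\in[n]$ there is no $t$-scarce allocation with welfare greater than $t/\alpha(t)$; and may output anything otherwise. $\mathcal{V}$ is strongly $\alpha(\cdot)$-inapproximable in $z$ communication if solving $(\mathcal{V},\alpha(\cdot))$-GapWelfare with probability $2/3$ (on every input) requires $z$ communication. The constants hidden in $O(\cdot)$ and $\Omega(\cdot)$ are absolute. *)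

theory Defs
  imports "HOL-Probability.Probability"
begin

type_synonym valuation = "nat set \<Rightarrow> real"

text \<open>The items are \<open>{1..m}\<close>, the bidders are \<open>{1..n}\<close>. Functions on finite domains are
  taken to be extensional, so that they carry no data outside their domain.
  A valuation is not required to vanish on the empty set.\<close>

definition valuations :: "nat \<Rightarrow> valuation set" where
  "valuations m = {v \<in> Pow {1..m} \<rightarrow>\<^sub>E {0..}. mono_on (Pow {1..m}) v}"

definition subadditive_valuations :: "nat \<Rightarrow> valuation set" where
  "subadditive_valuations m =
     {v \<in> valuations m. \<forall>S \<subseteq> {1..m}. \<forall>T \<subseteq> {1..m}. v (S \<union> T) \<le> v S + v T}"

definition allocations :: "nat \<Rightarrow> nat \<Rightarrow> (nat \<Rightarrow> nat set) set" where
  "allocations n m = {A \<in> {1..n} \<rightarrow>\<^sub>E Pow {1..m}. disjoint_family_on A {1..n}}"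

definition welfare :: "nat \<Rightarrow> (nat \<Rightarrow> valuation) \<Rightarrow> (nat \<Rightarrow> nat set) \<Rightarrow> real" where
  "welfare n f A = (\<Sum>i\<in>{1..n}. f i (A i))"

definition max_welfare :: "nat \<Rightarrow> nat \<Rightarrow> (nat \<Rightarrow> valuation) \<Rightarrow> real" where
  "max_welfare n m f = Max (welfare n f ` allocations n m)"

definition scarce :: "nat \<Rightarrow> nat \<Rightarrow> (nat \<Rightarrow> nat set) \<Rightarrow> bool" where
  "scarce n t A \<longleftrightarrow> card {i \<in> {1..n}. A i \<noteq> {}} \<le> t"

text \<open>Deterministic number-in-hand blackboard protocols. The position in the tree is the content
  of the blackboard; it determines who writes the next bit, and that bit depends only on the
  speaker's own input. The output is a function of the final content of the blackboard.\<close>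

datatype 'x protocol =
    Output bool
  | Speak (speaker: nat) (bit: "'x \<Rightarrow> bool") (if_one: "'x protocol") (if_zero: "'x protocol")

primrec outcome :: "'x protocol \<Rightarrow> (nat \<Rightarrow> 'x) \<Rightarrow> bool" where
  "outcome (Output b) f = b"
| "outcome (Speak i q P Q) f = (if q (f i) then outcome P f else outcome Q f)"

primrec cost :: "'x protocol \<Rightarrow> nat" where
  "cost (Output b) = 0"
| "cost (Speak i q P Q) = Suc (max (cost P) (cost Q))"

primrec speakers :: "'x protocol \<Rightarrow> nat set" where
  "speakers (Output b) = {}"
| "speakers (Speak i q P Q) = insert i (speakers P \<union> speakers Q)"

text \<open>A randomized (public-coin) protocol is an arbitrary probability distribution over
  deterministic protocols; private coins are a special case. The number \<open>k\<close> bounds the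
  worst-case number of bits written.\<close>

definition randomized_protocol :: "nat \<Rightarrow> nat \<Rightarrow> 'x protocol measure \<Rightarrow> bool" where
  "randomized_protocol n k R \<longleftrightarrow>
     prob_space R \<and> (\<forall>P\<in>space R. speakers P \<subseteq> {1..n} \<and> cost P \<le> k)"

definition must_output_one :: "nat \<Rightarrow> nat \<Rightarrow> (nat \<Rightarrow> valuation) \<Rightarrow> bool" where
  "must_output_one n m f \<longleftrightarrow> max_welfare n m f = real n"

definition must_output_zero ::
    "nat \<Rightarrow> nat \<Rightarrow> (nat \<Rightarrow> real) \<Rightarrow> (nat \<Rightarrow> valuation) \<Rightarrow> bool" where
  "must_output_zero n m \<alpha> f \<longleftrightarrow>
     (\<forall>t\<in>{1..n}. \<not> (\<exists>A\<in>allocations n m. scarce n t A \<and> welfare n f A > real t / \<alpha> t))"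

text \<open>A set that is not measurable has \<^const>\<open>measure\<close> 0, so the bounds below include
  the measurability of the respective events.\<close>

definition solves_gap_welfare ::
    "nat \<Rightarrow> nat \<Rightarrow> valuation set \<Rightarrow> (nat \<Rightarrow> real) \<Rightarrow> valuation protocol measure \<Rightarrow> bool" where
  "solves_gap_welfare n m V \<alpha> R \<longleftrightarrow>
     (\<forall>f \<in> {1..n} \<rightarrow>\<^sub>E V.
        (must_output_one n m f \<longrightarrow> measure R {P \<in> space R. outcome P f} \<ge> 2 / 3) \<and>
        (must_output_zero n m \<alpha> f \<longrightarrow> measure R {P \<in> space R. \<not> outcome P f} \<ge> 2 / 3))"

definition strongly_inapproximable ::
    "nat \<Rightarrow> nat \<Rightarrow> valuation set \<Rightarrow> (nat \<Rightarrow> real) \<Rightarrow> real \<Rightarrow> bool" where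
  "strongly_inapproximable n m V \<alpha> z \<longleftrightarrow>
     (\<forall>k R. randomized_protocol n k R \<and> solves_gap_welfare n m V \<alpha> R \<longrightarrow> z \<le> real k)"

end

theory Submission
  imports Defs
begin

text \<open>Take exponentially many (in \<open>sqrt m\<close>) partitions of the items into \<open>n\<close> parts such that any
  \<open>2 r\<close> parts of different partitions have a common item, where \<open>r\<close> is of order
  \<open>log m / log n\<close>; random partitions have this property. A player promotes one part of each
  partition with some strength. The complements of the promoted parts get a cost that decreases
  with the strength, and the value of a set is its covering cost \<open>g X\<close>, truncated at \<open>\<Lambda>\<close> and made
  self-dual: \<open>f X = \<Lambda> + g X - g (- X)\<close>. If all players promote nearly the same parts with nearly
  the same strength, then disjoint sets have total value about \<open>2 \<Lambda>\<close> for any two players, so \<open>t\<close>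
  players get about half of what would be \<open>t\<close> full values. If in one partition player \<open>q\<close> fully
  promotes part \<open>q\<close>, for all \<open>q\<close>, then every player gets the full value.

  Telling these cases apart is a gap version of \<open>n\<close>-party \<open>L\<^sub>\<infinity>\<close>, where the coordinates take values
  in a star with \<open>n\<close> legs. Its hardness follows the Hellinger distance method: with one random bit
  per coordinate, the level-one inequality replaces the information cost of the protocol; in an
  average coordinate the transcripts then hardly depend on single steps along the legs, hence
  (by the Pythagorean and the cut-and-paste property) they hardly distinguish all players being at
  the center from player \<open>q\<close> being at the tip of leg \<open>q\<close>, for all \<open>q\<close>. If \<open>m\<close> is at most a fixed
  power of \<open>n\<close>, then the error term allows \<open>\<alpha> t = t / n\<close>, and an instance with constant
  valuations must be answered both by 0 and by 1.\<close>

declare One_nat_def [simp del]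

section \<open>Transcripts\<close>

primrec transcript :: "'x protocol \<Rightarrow> (nat \<Rightarrow> 'x) \<Rightarrow> bool list" where
  "transcript (Output b) f = []"
| "transcript (Speak i q P Q) f =
     (if q (f i) then True # transcript P f else False # transcript Q f)"

primrec transcripts :: "'x protocol \<Rightarrow> bool list set" where
  "transcripts (Output b) = {[]}"
| "transcripts (Speak i q P Q) = Cons True ` transcripts P \<union> Cons False ` transcripts Q"

primrec verdict :: "'x protocol \<Rightarrow> bool list \<Rightarrow> bool" where
  "verdict (Output b) l = b"
| "verdict (Speak i q P Q) l = (if hd l then verdict P (tl l) else verdict Q (tl l))"

text \<open>The condition that leaf \<open>l\<close> imposes on the input of player \<open>p\<close>
  alone; bits written by others are read off from \<open>l\<close>.\<close>

primrec compatible :: "'x protocol \<Rightarrow> bool list \<Rightarrow> nat \<Rightarrow> 'x \<Rightarrow> bool" where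
  "compatible (Output b) l p x = True"
| "compatible (Speak i q P Q) l p x =
     ((p = i \<longrightarrow> q x = hd l) \<and>
      (if hd l then compatible P (tl l) p x else compatible Q (tl l) p x))"

lemma finite_transcripts [simp]: "finite (transcripts P)"
  by (induction P) auto

lemma card_transcripts: "card (transcripts P) \<le> 2 ^ cost P"
proof (induction P)
  case (Speak i q P Q)
  have "card (transcripts (Speak i q P Q)) \<le> card (transcripts P) + card (transcripts Q)"
    using card_Un_le[of "Cons True ` transcripts P" "Cons False ` transcripts Q"]
    by (simp add: card_image)
  also have "\<dots> \<le> 2 ^ max (cost P) (cost Q) + 2 ^ max (cost P) (cost Q)"
    using Speak by (intro add_mono; elim order_trans) (auto intro: power_increasing)
  finally show ?case by simp
qed simp

lemma transcript_in_transcripts: "transcript P f \<in> transcripts P"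
  by (induction P) auto

lemma outcome_eq_verdict: "outcome P f = verdict P (transcript P f)"
  by (induction P) auto

text \<open>The rectangle property: every bit on the path constrains only its speaker, so the inputs
  reaching a leaf form a product set.\<close>

lemma transcript_eq_iff:
  assumes "speakers P \<subseteq> I" "l \<in> transcripts P"
  shows "transcript P f = l \<longleftrightarrow> (\<forall>p\<in>I. compatible P l p (f p))"
  using assms
proof (induction P arbitrary: l)
  case (Speak i q P Q)
  hence P: "(transcript P f = l') = (\<forall>p\<in>I. compatible P l' p (f p))" if "l' \<in> transcripts P" for l'
    using that by auto
  from Speak have Q: "(transcript Q f = l') = (\<forall>p\<in>I. compatible Q l' p (f p))"
    if "l' \<in> transcripts Q" for l'
    using that by auto
  have "i \<in> I" using Speak by auto
  from Speak.prems(2) obtain l' where "l = True # l' \<and> l' \<in> transcripts P \<or> l = False # l' \<and> l' \<in> transcripts Q"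
    by auto
  thus ?case using \<open>i \<in> I\<close> P[of l'] Q[of l'] by (auto split: if_splits)
qed simp

section \<open>Hellinger distance for distributions of product form\<close>

text \<open>Player \<open>p\<close> with input \<open>v\<close> contributes the factor
  \<open>\<psi> p v l\<close> to the square root of the probability of leaf \<open>l\<close>. In
  this normalization \<open>hell\<close> is sqrt 2 times the usual Hellinger distance.\<close>

locale amplitudes =
  fixes I :: "'p set" and \<L> :: "'l set" and \<psi> :: "'p \<Rightarrow> 'a \<Rightarrow> 'l \<Rightarrow> real"
  assumes finite_I: "finite I" and finite_L: "finite \<L>"
    and nonneg: "\<psi> p v l \<ge> 0"
    and normalized: "(\<Sum>l\<in>\<L>. (\<Prod>p\<in>I. \<psi> p (u p) l)\<^sup>2) = 1"
begin

definition amp :: "('p \<Rightarrow> 'a) \<Rightarrow> 'l \<Rightarrow> real" where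
  "amp u l = (\<Prod>p\<in>I. \<psi> p (u p) l)"

definition hell :: "('p \<Rightarrow> 'a) \<Rightarrow> ('p \<Rightarrow> 'a) \<Rightarrow> real" where
  "hell u v = L2_set (\<lambda>l. amp u l - amp v l) \<L>"

lemma amp_nonneg: "amp u l \<ge> 0"
  by (simp add: amp_def nonneg prod_nonneg)

lemma sum_amp: "(\<Sum>l\<in>\<L>. (amp u l)\<^sup>2) = 1"
  using normalized by (simp add: amp_def)

lemma amp_cong: "(\<And>p. p \<in> I \<Longrightarrow> u p = v p) \<Longrightarrow> amp u l = amp v l"
  unfolding amp_def by (intro prod.cong) auto

lemma hell_cong:
  "(\<And>p. p \<in> I \<Longrightarrow> u p = u' p) \<Longrightarrow> (\<And>p. p \<in> I \<Longrightarrow> v p = v' p) \<Longrightarrow> hell u v = hell u' v'"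
  unfolding hell_def using amp_cong[of u u'] amp_cong[of v v'] by simp

lemma hell_nonneg: "hell u v \<ge> 0"
  by (simp add: hell_def)

lemma hell_same: "hell u u = 0"
  by (simp add: hell_def L2_set_def)

lemma hell_commute: "hell u v = hell v u"
  by (simp add: hell_def L2_set_def power2_commute)

lemma hell_triangle: "hell u w \<le> hell u v + hell v w"
  using L2_set_triangle_ineq[of "\<lambda>l. amp u l - amp v l" "\<lambda>l. amp v l - amp w l" \<L>]
  by (simp add: hell_def)

lemma hell_square: "(hell u v)\<^sup>2 = 2 - 2 * (\<Sum>l\<in>\<L>. amp u l * amp v l)"
proof -
  have "(hell u v)\<^sup>2 = (\<Sum>l\<in>\<L>. (amp u l - amp v l)\<^sup>2)"
    by (simp add: hell_def L2_set_def sum_nonneg)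
  also have "\<dots> = (\<Sum>l\<in>\<L>. (amp u l)\<^sup>2) + (\<Sum>l\<in>\<L>. (amp v l)\<^sup>2) - 2 * (\<Sum>l\<in>\<L>. amp u l * amp v l)"
    by (simp add: power2_diff sum.distrib sum_subtractf sum_distrib_left mult.assoc)
  finally show ?thesis
    by (simp add: sum_amp)
qed

definition swapped :: "('p \<Rightarrow> 'a) \<Rightarrow> ('p \<Rightarrow> 'a) \<Rightarrow> ('p \<Rightarrow> 'a) \<Rightarrow> ('p \<Rightarrow> 'a) \<Rightarrow> bool" where
  "swapped u v u' v' \<longleftrightarrow>
     (\<forall>p\<in>I. u' p = u p \<and> v' p = v p \<or> u' p = v p \<and> v' p = u p)"

lemma amp_swap:
  assumes "swapped u v u' v'"
  shows "amp u l * amp v l = amp u' l * amp v' l"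
  unfolding amp_def prod.distrib[symmetric]
  by (rule prod.cong) (use assms in \<open>auto simp: swapped_def\<close>)

text \<open>Cut and paste: \<open>amp u l * amp v l\<close> depends only on the unordered pair of
  values of each player in \<open>u\<close> and \<open>v\<close>.\<close>

lemma hell_swap:
  assumes "swapped u v u' v'"
  shows "hell u v = hell u' v'"
proof -
  have "(hell u v)\<^sup>2 = (hell u' v')\<^sup>2"
    unfolding hell_square using amp_swap[OF assms] by simp
  thus ?thesis
    using hell_nonneg power2_eq_iff_nonneg by blast
qed

text \<open>The Pythagorean property. By cut and paste, \<open>amp u l * amp v l\<close> is the
  geometric mean of \<open>amp u l * amp x l\<close> and \<open>amp y l * amp v l\<close>; AM-GM
  bounds a sum of two squared distances, one of which is dropped.\<close>

lemma hell_upd_le: "(hell u (u(p := v p)))\<^sup>2 \<le> 2 * (hell u v)\<^sup>2"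
proof -
  define x where "x = u(p := v p)"
  define y where "y = v(p := u p)"
  have pt: "2 * (amp u l * amp v l) \<le> amp u l * amp x l + amp y l * amp v l" for l
  proof -
    have "amp u l * amp v l = amp x l * amp y l"
      by (rule amp_swap) (auto simp: swapped_def x_def y_def)
    hence "(2 * (amp u l * amp v l))\<^sup>2 = 4 * ((amp u l * amp x l) * (amp y l * amp v l))"
      by (simp add: power2_eq_square algebra_simps)
    also have "\<dots> \<le> (amp u l * amp x l + amp y l * amp v l)\<^sup>2"
      using sum_squares_bound[of "amp u l * amp x l" "amp y l * amp v l"]
      unfolding power2_sum by linarith
    finally show ?thesis
      by (rule power2_le_imp_le) (simp add: amp_nonneg)
  qed
  have "2 * (\<Sum>l\<in>\<L>. amp u l * amp v l) \<le> (\<Sum>l\<in>\<L>. amp u l * amp x l) + (\<Sum>l\<in>\<L>. amp y l * amp v l)"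
    unfolding sum_distrib_left sum.distrib[symmetric] by (rule sum_mono) (rule pt)
  moreover have "0 \<le> (hell y v)\<^sup>2" by simp
  ultimately show ?thesis
    unfolding hell_square x_def[symmetric] by simp
qed

text \<open>In the induction, cut and paste moves the change of player \<open>p\<close> from the
  right argument to the left one; the triangle inequality through \<open>u\<close> then splits it
  off.\<close>

lemma hell_le_sum_upd:
  assumes "S \<subseteq> I"
  shows "hell u (\<lambda>p. if p \<in> S then v p else u p) \<le> (\<Sum>p\<in>S. hell u (u(p := v p)))"
proof -
  have "finite S" using assms finite_I finite_subset by blast
  thus ?thesis using assms
  proof (induction S)
    case empty
    show ?case by (simp add: hell_same)
  next
    case (insert p S)
    define w where "w = (\<lambda>q. if q \<in> S then v q else u q)"
    have "hell u (\<lambda>q. if q \<in> insert p S then v q else u q) = hell (u(p := v p)) w"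
      by (rule hell_swap) (use insert in \<open>auto simp: swapped_def w_def\<close>)
    also have "\<dots> \<le> hell u (u(p := v p)) + hell u w"
      using hell_triangle[of "u(p := v p)" w u] hell_commute[of "u(p := v p)" u] by simp
    also have "hell u w \<le> (\<Sum>p\<in>S. hell u (u(p := v p)))"
      unfolding w_def by (rule insert.IH) (use insert in auto)
    finally show ?case by (simp only: sum.insert[OF insert.hyps])
  qed
qed

lemma hell_chain: "hell (u 0) (u L) \<le> (\<Sum>j<L. hell (u j) (u (Suc j)))"
proof (induction L)
  case (Suc L)
  thus ?case using hell_triangle[of "u 0" "u (Suc L)" "u L"] by simp
qed (simp add: hell_same)

lemma accept_diff_le:
  assumes "A \<subseteq> \<L>"
  shows "(\<Sum>l\<in>A. (amp v l)\<^sup>2) - (\<Sum>l\<in>A. (amp u l)\<^sup>2) \<le> 6 * (hell u v)\<^sup>2 + 1 / 6"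
proof -
  have pt: "(amp v l)\<^sup>2 - (amp u l)\<^sup>2 \<le> 6 * (amp u l - amp v l)\<^sup>2 + ((amp v l)\<^sup>2 + (amp u l)\<^sup>2) / 12" for l
  proof -
    define x where "x = amp v l"
    define y where "y = amp u l"
    \<comment> \<open>The constants keep the additive loss at 1/6, half of the gap 1/3 available in
      \<open>distributional_bound\<close>.\<close>
    have "0 \<le> (12 * (x - y) - (x + y))\<^sup>2 + (x - y)\<^sup>2" by simp
    hence "24 * (x\<^sup>2 - y\<^sup>2) \<le> 144 * (y - x)\<^sup>2 + 2 * (x\<^sup>2 + y\<^sup>2)"
      by (simp add: power2_eq_square algebra_simps)
    moreover have "A \<le> 6 * B + D / 12" if "24 * A \<le> 144 * B + 2 * D" for A B D :: real
      using that by simp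
    ultimately have "x\<^sup>2 - y\<^sup>2 \<le> 6 * (y - x)\<^sup>2 + (x\<^sup>2 + y\<^sup>2) / 12"
      by blast
    thus ?thesis by (simp add: x_def y_def)
  qed
  have "(\<Sum>l\<in>A. (amp v l)\<^sup>2) - (\<Sum>l\<in>A. (amp u l)\<^sup>2) \<le>
        (\<Sum>l\<in>A. 6 * (amp u l - amp v l)\<^sup>2 + ((amp v l)\<^sup>2 + (amp u l)\<^sup>2) / 12)"
    unfolding sum_subtractf[symmetric] by (rule sum_mono) (rule pt)
  also have "\<dots> \<le> (\<Sum>l\<in>\<L>. 6 * (amp u l - amp v l)\<^sup>2 + ((amp v l)\<^sup>2 + (amp u l)\<^sup>2) / 12)"
    by (rule sum_mono2) (use assms finite_L in auto)
  also have "\<dots> = 6 * (hell u v)\<^sup>2 + 1 / 6"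
    by (simp add: sum.distrib sum_distrib_left[symmetric] sum_divide_distrib[symmetric] sum_amp
        hell_def L2_set_def sum_nonneg)
  finally show ?thesis .
qed

end

section \<open>The level-one inequality\<close>

text \<open>A form of cosh a \<le> exp (a^2 / 2) with a weaker constant: random signs are
  sub-Gaussian.\<close>

lemma exp_plus_exp_minus_le: "exp a + exp (- a) \<le> 2 * exp (a\<^sup>2)" for a :: real
proof (cases "\<bar>a\<bar> \<le> 1")
  case True
  have *: "exp x + exp (- x) \<le> 2 * exp (x\<^sup>2)" if "0 \<le> x" "x \<le> 1" for x :: real
  proof -
    have "exp x \<le> 1 + x + x\<^sup>2" using exp_bound that by blast
    moreover have "exp (- x) \<le> 1 - x + x\<^sup>2"
    proof -
      have "1 \<le> (1 + x) * (1 - x + x\<^sup>2)"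
        using that by (simp add: algebra_simps power2_eq_square)
      also have "\<dots> \<le> exp x * (1 - x + x\<^sup>2)"
        using that by (intro mult_right_mono exp_ge_add_one_self) auto
      finally show ?thesis by (simp add: exp_minus field_simps)
    qed
    moreover have "1 + x\<^sup>2 \<le> exp (x\<^sup>2)" by (rule exp_ge_add_one_self)
    ultimately show ?thesis by linarith
  qed
  show ?thesis
    using *[of "\<bar>a\<bar>"] True by (cases "a \<ge> 0") (auto simp: add.commute)
next
  case False
  hence "\<bar>a\<bar> * 1 \<le> \<bar>a\<bar> * \<bar>a\<bar>" by (intro mult_left_mono) auto
  hence "\<bar>a\<bar> \<le> a\<^sup>2" by (simp add: power2_eq_square)
  hence "exp a \<le> exp (a\<^sup>2)" "exp (- a) \<le> exp (a\<^sup>2)" by auto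
  thus ?thesis by linarith
qed

text \<open>The involutions \<open>\<phi> i\<close> make the signs independent and uniform under the
  uniform distribution on \<open>\<Omega>\<close>, which may carry further randomness.\<close>

locale sign_cube =
  fixes \<Omega> :: "'w set" and T :: "'i set" and sg :: "'i \<Rightarrow> 'w \<Rightarrow> real" and \<phi> :: "'i \<Rightarrow> 'w \<Rightarrow> 'w"
  assumes finite_\<Omega>: "finite \<Omega>" and finite_T: "finite T"
    and sign: "sg i \<omega> = 1 \<or> sg i \<omega> = -1"
    and flip_in: "i \<in> T \<Longrightarrow> \<omega> \<in> \<Omega> \<Longrightarrow> \<phi> i \<omega> \<in> \<Omega>"
    and flip_flip: "i \<in> T \<Longrightarrow> \<omega> \<in> \<Omega> \<Longrightarrow> \<phi> i (\<phi> i \<omega>) = \<omega>"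
    and flip_sign: "i \<in> T \<Longrightarrow> \<omega> \<in> \<Omega> \<Longrightarrow> sg i (\<phi> i \<omega>) = - sg i \<omega>"
    and flip_other: "i \<in> T \<Longrightarrow> j \<in> T \<Longrightarrow> j \<noteq> i \<Longrightarrow> \<omega> \<in> \<Omega> \<Longrightarrow> sg j (\<phi> i \<omega>) = sg j \<omega>"
begin

lemma sum_flip: "i \<in> T \<Longrightarrow> (\<Sum>\<omega>\<in>\<Omega>. F (\<phi> i \<omega>)) = (\<Sum>\<omega>\<in>\<Omega>. F \<omega>)"
  by (rule sum.reindex_bij_witness[where i = "\<phi> i" and j = "\<phi> i"]) (auto simp: flip_in flip_flip)

text \<open>Averaging over the flip of one coordinate turns its factor into a hyperbolic cosine; the
  other factors do not notice the flip.\<close>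

lemma exp_moment:
  assumes "U \<subseteq> T"
  shows "(\<Sum>\<omega>\<in>\<Omega>. exp (\<Sum>i\<in>U. a i * sg i \<omega>)) \<le> card \<Omega> * exp (\<Sum>i\<in>U. (a i)\<^sup>2)"
proof -
  have "finite U" using assms finite_T finite_subset by blast
  thus ?thesis using assms
  proof (induction U)
    case empty
    show ?case by simp
  next
    case (insert i U)
    define F where "F \<omega> = exp (\<Sum>j\<in>U. a j * sg j \<omega>)" for \<omega>
    have i: "i \<in> T" using insert by auto
    have F_flip: "F (\<phi> i \<omega>) = F \<omega>" if "\<omega> \<in> \<Omega>" for \<omega>
    proof -
      have "sg j (\<phi> i \<omega>) = sg j \<omega>" if "j \<in> U" for j
        using flip_other[OF i _ _ \<open>\<omega> \<in> \<Omega>\<close>, of j] insert that by auto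
      thus ?thesis by (simp add: F_def)
    qed
    have "(\<Sum>\<omega>\<in>\<Omega>. exp (\<Sum>j\<in>insert i U. a j * sg j \<omega>)) = (\<Sum>\<omega>\<in>\<Omega>. F \<omega> * exp (a i * sg i \<omega>))"
      using insert by (simp add: F_def exp_add mult.commute)
    hence "2 * (\<Sum>\<omega>\<in>\<Omega>. exp (\<Sum>j\<in>insert i U. a j * sg j \<omega>)) =
        (\<Sum>\<omega>\<in>\<Omega>. F \<omega> * exp (a i * sg i \<omega>)) +
        (\<Sum>\<omega>\<in>\<Omega>. F (\<phi> i \<omega>) * exp (a i * sg i (\<phi> i \<omega>)))"
      using sum_flip[OF i, of "\<lambda>\<omega>. F \<omega> * exp (a i * sg i \<omega>)"] by simp
    also have "\<dots> = (\<Sum>\<omega>\<in>\<Omega>. F \<omega> * (exp (a i * sg i \<omega>) + exp (- (a i * sg i \<omega>))))"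
      unfolding sum.distrib[symmetric]
      by (rule sum.cong) (auto simp: F_flip flip_sign[OF i] distrib_left)
    also have "\<dots> \<le> (\<Sum>\<omega>\<in>\<Omega>. F \<omega> * (2 * exp ((a i)\<^sup>2)))"
    proof (intro sum_mono mult_left_mono)
      fix \<omega>
      have "(a i * sg i \<omega>)\<^sup>2 = (a i)\<^sup>2" using sign[of i \<omega>] by auto
      thus "exp (a i * sg i \<omega>) + exp (- (a i * sg i \<omega>)) \<le> 2 * exp ((a i)\<^sup>2)"
        using exp_plus_exp_minus_le[of "a i * sg i \<omega>"] by simp
    qed (simp add: F_def)
    also have "\<dots> = 2 * exp ((a i)\<^sup>2) * (\<Sum>\<omega>\<in>\<Omega>. F \<omega>)"
      by (subst mult.commute) (simp only: sum_distrib_right)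
    also have "\<dots> \<le> 2 * exp ((a i)\<^sup>2) * (card \<Omega> * exp (\<Sum>i\<in>U. (a i)\<^sup>2))"
      using insert by (intro mult_left_mono) (auto simp: F_def)
    also have "\<dots> = 2 * (card \<Omega> * exp (\<Sum>i\<in>insert i U. (a i)\<^sup>2))"
      using insert by (simp add: exp_add)
    finally show ?case by simp
  qed
qed

text \<open>Test the exponential moment against the mean of \<open>sg\<close> over \<open>S\<close>.\<close>

lemma level_one:
  assumes S: "S \<subseteq> \<Omega>" "S \<noteq> {}"
  shows "(\<Sum>i\<in>T. ((\<Sum>\<omega>\<in>S. sg i \<omega>) / card S)\<^sup>2) \<le> 4 * ln (card \<Omega> / card S)"
proof -
  have fS: "finite S" using S finite_\<Omega> finite_subset by blast
  hence cS: "card S > 0" using S by (simp add: card_gt_0_iff)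
  have c\<Omega>: "card \<Omega> > 0" using S finite_\<Omega> by (auto simp: card_gt_0_iff)
  define a where "a i = (\<Sum>\<omega>\<in>S. sg i \<omega>) / card S" for i
  define s where "s = (\<Sum>i\<in>T. (a i)\<^sup>2)"
  \<comment> \<open>With coefficient \<lambda> in place of 1/2, the mean of \<open>Z\<close> on
    \<open>S\<close> is \<lambda> s and the moment bound costs \<lambda>^2 s; the difference is
    largest, s/4, at \<lambda> = 1/2.\<close>
  define Z where "Z \<omega> = (\<Sum>i\<in>T. (a i / 2) * sg i \<omega>)" for \<omega>
  have "(\<Sum>\<omega>\<in>S. Z \<omega>) = (\<Sum>i\<in>T. (a i / 2) * (\<Sum>\<omega>\<in>S. sg i \<omega>))"
    unfolding Z_def by (subst sum.swap) (simp add: sum_distrib_left)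
  also have "\<dots> = (\<Sum>i\<in>T. card S * ((a i)\<^sup>2 / 2))"
    by (rule sum.cong) (use cS in \<open>auto simp: a_def power2_eq_square\<close>)
  also have "\<dots> = card S * (s / 2)"
    by (simp add: s_def sum_distrib_left sum_divide_distrib)
  finally have Z: "(\<Sum>\<omega>\<in>S. Z \<omega>) = card S * (s / 2)" .
  \<comment> \<open>Jensen's inequality, by the tangent to exp at the mean \<open>s / 2\<close> of
    \<open>Z\<close> on \<open>S\<close>.\<close>
  have "card S * exp (s / 2) = (\<Sum>\<omega>\<in>S. exp (s / 2) * (1 + (Z \<omega> - s / 2)))"
    unfolding sum_distrib_left[symmetric] sum.distrib sum_subtractf Z by simp
  also have "\<dots> \<le> (\<Sum>\<omega>\<in>S. exp (s / 2) * exp (Z \<omega> - s / 2))"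
    by (intro sum_mono mult_left_mono exp_ge_add_one_self) simp
  also have "\<dots> = (\<Sum>\<omega>\<in>S. exp (Z \<omega>))"
    by (simp add: exp_add[symmetric])
  also have "\<dots> \<le> (\<Sum>\<omega>\<in>\<Omega>. exp (Z \<omega>))"
    by (rule sum_mono2) (use S finite_\<Omega> in auto)
  also have "\<dots> \<le> card \<Omega> * exp (\<Sum>i\<in>T. (a i / 2)\<^sup>2)"
    unfolding Z_def by (rule exp_moment) simp
  also have "(\<Sum>i\<in>T. (a i / 2)\<^sup>2) = s / 4"
    by (simp add: s_def sum_divide_distrib power_divide)
  finally have "card S * exp (s / 2) \<le> card \<Omega> * exp (s / 4)" .
  hence "ln (card S * exp (s / 2)) \<le> ln (card \<Omega> * exp (s / 4))"
    using cS c\<Omega> by simp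
  hence "s / 4 \<le> ln (card \<Omega>) - ln (card S)"
    using cS c\<Omega> by (simp add: ln_mult)
  thus ?thesis
    using cS c\<Omega> by (simp add: s_def a_def ln_div)
qed

text \<open>The flip exchanges the two halves of the cube, so conditioning on one bit amounts to a
  factor 2.\<close>

lemma sum_flip_invariant:
  assumes i: "i \<in> T" and inv: "\<And>\<omega>. \<omega> \<in> \<Omega> \<Longrightarrow> F (\<phi> i \<omega>) = F \<omega>" and s: "s = 1 \<or> s = -1"
  shows "(\<Sum>\<omega>\<in>\<Omega>. F \<omega>) = 2 * (\<Sum>\<omega>\<in>\<Omega>. if sg i \<omega> = s then F \<omega> else (0::real))"
proof -
  have "(\<Sum>\<omega>\<in>\<Omega>. if sg i \<omega> = s then F \<omega> else 0) + (\<Sum>\<omega>\<in>\<Omega>. if sg i \<omega> = s then F \<omega> else 0) =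
    (\<Sum>\<omega>\<in>\<Omega>. if sg i \<omega> = s then F \<omega> else 0) +
    (\<Sum>\<omega>\<in>\<Omega>. if sg i (\<phi> i \<omega>) = s then F (\<phi> i \<omega>) else 0)"
    using sum_flip[OF i, of "\<lambda>\<omega>. if sg i \<omega> = s then F \<omega> else 0"] by simp
  also have "\<dots> = (\<Sum>\<omega>\<in>\<Omega>. F \<omega>)"
    unfolding sum.distrib[symmetric]
    by (rule sum.cong) (use s sign in \<open>auto simp: inv flip_sign[OF i]\<close>, (metis minus_equation_iff)+)
  finally show ?thesis by simp
qed

end

section \<open>The gap problem on a star\<close>

text \<open>Gibbs' inequality against the uniform distribution, from ln z \<le> z - 1.\<close>

lemma sum_entropy_le:
  fixes \<beta> :: "'l \<Rightarrow> real"
  assumes "finite \<L>" and nonneg: "\<And>l. l \<in> \<L> \<Longrightarrow> \<beta> l \<ge> 0" and "(\<Sum>l\<in>\<L>. \<beta> l) = 1"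
  shows "(\<Sum>l\<in>\<L>. \<beta> l * ln (1 / \<beta> l)) \<le> ln (card \<L>)"
proof -
  have "\<L> \<noteq> {}" using assms by auto
  hence N: "real (card \<L>) > 0" using assms by (simp add: card_gt_0_iff)
  have "\<beta> l * ln (1 / \<beta> l) - \<beta> l * ln (card \<L>) \<le> 1 / card \<L> - \<beta> l" if l: "l \<in> \<L>" for l
  proof (cases "\<beta> l = 0")
    case False
    hence b: "\<beta> l > 0" using nonneg[OF l] by simp
    have "\<beta> l * ln (1 / \<beta> l) - \<beta> l * ln (card \<L>) = \<beta> l * ln (1 / (\<beta> l * card \<L>))"
      using b N by (simp add: ln_div ln_mult algebra_simps)
    also have "\<dots> \<le> \<beta> l * (1 / (\<beta> l * card \<L>) - 1)"
      using b N by (intro mult_left_mono ln_le_minus_one) auto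
    also have "\<dots> = 1 / card \<L> - \<beta> l"
      using b by (simp add: right_diff_distrib)
    finally show ?thesis .
  qed simp
  hence "(\<Sum>l\<in>\<L>. \<beta> l * ln (1 / \<beta> l) - \<beta> l * ln (card \<L>)) \<le> (\<Sum>l\<in>\<L>. 1 / card \<L> - \<beta> l)"
    by (rule sum_mono)
  thus ?thesis using N assms(3)
    by (simp add: sum_subtractf sum_distrib_right[symmetric])
qed

text \<open>Holds since (sqrt x + sqrt y)^2 \<ge> x + y. It bounds a Hellinger term by a squared
  bias, which the level-one inequality controls.\<close>

lemma sqrt_diff_square_le:
  fixes x y :: real
  assumes "x \<ge> 0" "y \<ge> 0"
  shows "(sqrt x - sqrt y)\<^sup>2 \<le> (x - y)\<^sup>2 / (x + y)"
proof (cases "x + y = 0")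
  case True
  thus ?thesis using assms by simp
next
  case False
  hence "x + y > 0" using assms by linarith
  have "(sqrt x - sqrt y)\<^sup>2 * (x + y) \<le> (sqrt x - sqrt y)\<^sup>2 * (sqrt x + sqrt y)\<^sup>2"
    using assms by (intro mult_left_mono) (auto simp: power2_sum)
  also have "\<dots> = (x - y)\<^sup>2"
    using assms by (simp add: power_mult_distrib[symmetric] algebra_simps)
  finally show ?thesis using \<open>x + y > 0\<close> by (simp add: pos_le_divide_eq)
qed

lemma sqrt_prod: "sqrt (\<Prod>i\<in>A. f i) = (\<Prod>i\<in>A. sqrt (f i))"
  by (induction A rule: infinite_finite_induct) (auto simp: real_sqrt_mult)

text \<open>A direction \<open>(a, j, p)\<close> stands for the step from \<open>\<gamma> a j\<close> to \<open>\<gamma> a (j + 1)\<close> in the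
  middle of the hybrid argument over the players: those before \<open>p\<close> have made the step, those after
  \<open>p\<close> have not, and a random bit decides for \<open>p\<close>.\<close>

definition hybrid :: "(nat \<Rightarrow> nat \<Rightarrow> 'a) \<Rightarrow> nat \<times> nat \<times> nat \<Rightarrow> bool \<Rightarrow> nat \<Rightarrow> 'a" where
  "hybrid \<gamma> d b q =
     (case d of (a, j, p) \<Rightarrow> if q < p \<or> q = p \<and> b then \<gamma> a (Suc j) else \<gamma> a j)"

lemma hybrid_indep: "q \<noteq> snd (snd d) \<Longrightarrow> hybrid \<gamma> d b q = hybrid \<gamma> d b' q"
  by (auto simp: hybrid_def split: prod.splits)

locale star =
  fixes n K L :: nat and \<gamma> :: "nat \<Rightarrow> nat \<Rightarrow> 'a" and c :: 'a
    and enc :: "(nat \<Rightarrow> 'a) \<Rightarrow> 'x"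
  assumes center: "\<gamma> a 0 = c"
begin

definition \<Omega> :: "(nat \<Rightarrow> nat set) set" where
  "\<Omega> = {1..n} \<rightarrow>\<^sub>E Pow {..<K}"

definition dirs :: "(nat \<times> nat \<times> nat) set" where
  "dirs = {1..n} \<times> {..<L} \<times> {1..n}"

definition dir_choices :: "(nat \<Rightarrow> nat \<times> nat \<times> nat) set" where
  "dir_choices = {..<K} \<rightarrow>\<^sub>E dirs"

text \<open>Every player owns a bit for every coordinate, although the hybrid consults only that of
  the player named in \<open>D j\<close>. This makes \<open>\<Omega>\<close> a product over the
  players, so for fixed \<open>D\<close> their inputs are independent.\<close>

definition planted ::
    "(nat \<Rightarrow> nat \<times> nat \<times> nat) \<Rightarrow> nat \<Rightarrow> (nat \<Rightarrow> 'a) \<Rightarrow> (nat \<Rightarrow> nat set) \<Rightarrow> nat \<Rightarrow> nat \<Rightarrow> 'a" where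
  "planted D i u \<omega> q j = (if j = i then u q else hybrid \<gamma> (D j) (j \<in> \<omega> q) q)"

definition inputs :: "(nat \<Rightarrow> nat \<Rightarrow> 'a) \<Rightarrow> nat \<Rightarrow> 'x" where
  "inputs s = (\<lambda>q\<in>{1..n}. enc (s q))"

lemma finite_\<Omega>: "finite \<Omega>"
  by (simp add: \<Omega>_def finite_PiE)

lemma card_\<Omega>: "card \<Omega> = (2 ^ K) ^ n"
  by (simp add: \<Omega>_def card_PiE card_Pow)

lemma card_\<Omega>_pos: "real (card \<Omega>) > 0"
  by (simp add: card_\<Omega>)

lemma card_dirs: "card dirs = n\<^sup>2 * L"
  by (simp add: dirs_def card_cartesian_product power2_eq_square)

lemma finite_dirs: "finite dirs"
  by (simp add: dirs_def)

lemma finite_dir_choices: "finite dir_choices"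
  by (simp add: dir_choices_def finite_PiE finite_dirs)

text \<open>Exchanging \<open>d\<close> with \<open>D i\<close> is an involution on the pairs. A sum
  over all directions at coordinate \<open>i\<close> can thus be evaluated at the direction that
  \<open>D\<close> itself uses there.\<close>

lemma sum_dir_choices_resample:
  fixes G :: "(nat \<Rightarrow> nat \<times> nat \<times> nat) \<Rightarrow> nat \<times> nat \<times> nat \<Rightarrow> real"
  assumes i: "i < K" and inv: "\<And>D d e. G (D(i := e)) d = G D d"
  shows "(\<Sum>D\<in>dir_choices. \<Sum>d\<in>dirs. G D d) = card dirs * (\<Sum>D\<in>dir_choices. G D (D i))"
proof -
  have upd: "D(i := d) \<in> dir_choices" if "D \<in> dir_choices" "d \<in> dirs" for D d
    using that i by (auto simp: dir_choices_def PiE_iff extensional_def)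
  have in_dirs: "D i \<in> dirs" if "D \<in> dir_choices" for D
    using that i by (auto simp: dir_choices_def)
  have "(\<Sum>D\<in>dir_choices. \<Sum>d\<in>dirs. G D d) = (\<Sum>(D, d)\<in>dir_choices \<times> dirs. G D d)"
    by (rule sum.cartesian_product)
  also have "\<dots> = (\<Sum>(D, d)\<in>dir_choices \<times> dirs. G D (D i))"
    by (rule sum.reindex_bij_witness[where i = "\<lambda>(D, d). (D(i := d), D i)"
          and j = "\<lambda>(D, d). (D(i := d), D i)"])
      (auto simp: upd inv dest: in_dirs)
  also have "\<dots> = (\<Sum>D\<in>dir_choices. \<Sum>d\<in>dirs. G D (D i))"
    by (rule sum.cartesian_product[symmetric])
  also have "\<dots> = card dirs * (\<Sum>D\<in>dir_choices. G D (D i))"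
    by (simp only: sum_constant sum_distrib_left)
  finally show ?thesis .
qed

end

section \<open>Transcript distributions of one deterministic protocol\<close>

locale star_protocol = star n K L \<gamma> c enc
  for n K L :: nat and \<gamma> :: "nat \<Rightarrow> nat \<Rightarrow> 'a" and c :: 'a and enc :: "(nat \<Rightarrow> 'a) \<Rightarrow> 'x" +
  fixes P :: "'x protocol"
  assumes speakers: "speakers P \<subseteq> {1..n}"
begin

definition factor :: "(nat \<Rightarrow> nat \<times> nat \<times> nat) \<Rightarrow> nat \<Rightarrow> nat \<Rightarrow> 'a \<Rightarrow> bool list \<Rightarrow> real" where
  "factor D i q v l = (\<Sum>w\<in>Pow {..<K}. of_bool (compatible P l q
     (enc (\<lambda>j. if j = i then v else hybrid \<gamma> (D j) (j \<in> w) q)))) / 2 ^ K"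

definition leaf_prob :: "(nat \<Rightarrow> nat \<times> nat \<times> nat) \<Rightarrow> nat \<Rightarrow> (nat \<Rightarrow> 'a) \<Rightarrow> bool list \<Rightarrow> real" where
  "leaf_prob D i u l =
     (\<Sum>\<omega>\<in>\<Omega>. of_bool (transcript P (inputs (planted D i u \<omega>)) = l)) / card \<Omega>"

definition accept_prob :: "(nat \<Rightarrow> nat \<times> nat \<times> nat) \<Rightarrow> nat \<Rightarrow> (nat \<Rightarrow> 'a) \<Rightarrow> real" where
  "accept_prob D i u = (\<Sum>\<omega>\<in>\<Omega>. of_bool (outcome P (inputs (planted D i u \<omega>)))) / card \<Omega>"

text \<open>A leaf is a rectangle and the bits of different players are independent.\<close>

lemma leaf_prob_eq_prod:
  assumes "l \<in> transcripts P"
  shows "leaf_prob D i u l = (\<Prod>q\<in>{1..n}. factor D i q (u q) l)"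
proof -
  have *: "of_bool (transcript P (inputs (planted D i u \<omega>)) = l) = (\<Prod>q\<in>{1..n}. of_bool
     (compatible P l q (enc (\<lambda>j. if j = i then u q else hybrid \<gamma> (D j) (j \<in> \<omega> q) q))) :: real)" for \<omega>
    using assms transcript_eq_iff[OF speakers, of l "inputs (planted D i u \<omega>)"]
    by (auto simp: inputs_def planted_def[abs_def] of_bool_def prod_zero_iff)
  show ?thesis
    unfolding leaf_prob_def factor_def * \<Omega>_def
    by (subst prod_sum_PiE[symmetric]) (auto simp: prod_dividef card_PiE card_Pow)
qed

lemma sum_leaf_prob: "(\<Sum>l\<in>transcripts P. leaf_prob D i u l) = 1"
proof -
  have "(\<Sum>l\<in>transcripts P. leaf_prob D i u l) =
    (\<Sum>\<omega>\<in>\<Omega>. \<Sum>l\<in>transcripts P. of_bool (transcript P (inputs (planted D i u \<omega>)) = l)) / card \<Omega>"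
    unfolding leaf_prob_def sum_divide_distrib[symmetric] by (subst sum.swap) simp
  also have "\<dots> = 1"
    using card_\<Omega>_pos by (simp add: of_bool_def transcript_in_transcripts)
  finally show ?thesis .
qed

lemma factor_nonneg: "factor D i q v l \<ge> 0"
  by (simp add: factor_def sum_nonneg)

lemma prod_sqrt_factor:
  "l \<in> transcripts P \<Longrightarrow> (\<Prod>q\<in>{1..n}. sqrt (factor D i q (u q) l)) = sqrt (leaf_prob D i u l)"
  by (simp add: leaf_prob_eq_prod sqrt_prod)

lemma leaf_prob_nonneg: "leaf_prob D i u l \<ge> 0"
  by (simp add: leaf_prob_def sum_nonneg)

sublocale am: amplitudes "{1..n}" "transcripts P" "\<lambda>q v l. sqrt (factor D i q v l)" for D i
  by unfold_locales
    (auto simp: factor_nonneg prod_sqrt_factor leaf_prob_nonneg sum_leaf_prob)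

lemma amp_eq: "l \<in> transcripts P \<Longrightarrow> am.amp D i u l = sqrt (leaf_prob D i u l)"
  by (simp add: am.amp_def prod_sqrt_factor)

lemma accept_prob_eq:
  "accept_prob D i u = (\<Sum>l\<in>{l \<in> transcripts P. verdict P l}. (am.amp D i u l)\<^sup>2)"
proof -
  have "(\<Sum>l\<in>{l \<in> transcripts P. verdict P l}. (am.amp D i u l)\<^sup>2) =
    (\<Sum>l\<in>{l \<in> transcripts P. verdict P l}. leaf_prob D i u l)"
    by (rule sum.cong) (auto simp: amp_eq leaf_prob_nonneg)
  also have "\<dots> = (\<Sum>\<omega>\<in>\<Omega>. \<Sum>l\<in>{l \<in> transcripts P. verdict P l}.
      of_bool (transcript P (inputs (planted D i u \<omega>)) = l)) / card \<Omega>"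
    unfolding leaf_prob_def sum_divide_distrib[symmetric] by (subst sum.swap) simp
  also have "\<dots> = accept_prob D i u"
    unfolding accept_prob_def outcome_eq_verdict
    by (simp add: of_bool_def transcript_in_transcripts)
  finally show ?thesis by simp
qed

definition step_hell :: "(nat \<Rightarrow> nat \<times> nat \<times> nat) \<Rightarrow> nat \<Rightarrow> nat \<times> nat \<times> nat \<Rightarrow> real" where
  "step_hell D i d = am.hell D i (hybrid \<gamma> d False) (hybrid \<gamma> d True)"

text \<open>Planting overwrites coordinate \<open>i\<close>, so distances there ignore
  \<open>D i\<close>. This is the invariance required for resampling.\<close>

lemma step_hell_upd: "step_hell (D(i := e)) i d = step_hell D i d"
proof -
  have "factor (D(i := e)) i = factor D i"
    unfolding factor_def[abs_def]
    by (intro ext arg_cong2[where f = "(/)"] sum.cong refl arg_cong[where f = of_bool]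
        arg_cong[where f = "compatible P _ _"] arg_cong[where f = enc]) auto
  thus ?thesis by (simp add: step_hell_def)
qed

text \<open>Walk from the center to the tip of each leg by single steps; the Pythagorean property lets
  one player alone make this walk, and cut and paste combines these walks.\<close>

lemma hell_center_tips:
  "am.hell D i (\<lambda>_. c) (\<lambda>q. \<gamma> q L) \<le> sqrt 2 * (\<Sum>d\<in>dirs. step_hell D i d)"
proof -
  have step: "am.hell D i (\<lambda>_. \<gamma> a j) (\<lambda>_. \<gamma> a (Suc j)) \<le> (\<Sum>p=1..n. step_hell D i (a, j, p))" for a j
  proof -
    \<comment> \<open>In \<open>u k\<close> exactly the players up to \<open>k\<close> have moved;
      \<open>Suc k\<close> accounts for the strict comparison in \<open>hybrid\<close>.\<close>
    define u where "u = (\<lambda>k. hybrid \<gamma> (a, j, Suc k) False)"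
    have "am.hell D i (\<lambda>_. \<gamma> a j) (\<lambda>_. \<gamma> a (Suc j)) = am.hell D i (u 0) (u n)"
      by (rule am.hell_cong) (auto simp: u_def hybrid_def)
    also have "\<dots> \<le> (\<Sum>k<n. am.hell D i (u k) (u (Suc k)))"
      by (rule am.hell_chain)
    also have "\<dots> = (\<Sum>k<n. step_hell D i (a, j, Suc k))"
      unfolding step_hell_def
      by (intro sum.cong am.hell_cong) (auto simp: u_def hybrid_def)
    also have "\<dots> = (\<Sum>p=1..n. step_hell D i (a, j, p))"
      using sum.atLeast1_atMost_eq[of "\<lambda>p. step_hell D i (a, j, p)" n] by (simp add: One_nat_def)
    finally show ?thesis .
  qed
  have one: "am.hell D i (\<lambda>_. c) ((\<lambda>_. c)(a := \<gamma> a L)) \<le>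
      sqrt 2 * (\<Sum>j<L. \<Sum>p=1..n. step_hell D i (a, j, p))" for a
  proof -
    have "(am.hell D i (\<lambda>_. c) ((\<lambda>_. c)(a := \<gamma> a L)))\<^sup>2 \<le>
        (sqrt 2 * am.hell D i (\<lambda>_. c) (\<lambda>_. \<gamma> a L))\<^sup>2"
      using am.hell_upd_le[of D i "\<lambda>_. c" a "\<lambda>_. \<gamma> a L"] by (simp add: power_mult_distrib)
    hence "am.hell D i (\<lambda>_. c) ((\<lambda>_. c)(a := \<gamma> a L)) \<le> sqrt 2 * am.hell D i (\<lambda>_. c) (\<lambda>_. \<gamma> a L)"
      by (rule power2_le_imp_le) (simp add: am.hell_nonneg)
    also have "am.hell D i (\<lambda>_. c) (\<lambda>_. \<gamma> a L) \<le> (\<Sum>j<L. am.hell D i (\<lambda>_. \<gamma> a j) (\<lambda>_. \<gamma> a (Suc j)))"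
      using am.hell_chain[of D i "\<lambda>j _. \<gamma> a j" L] by (simp add: center)
    also have "\<dots> \<le> (\<Sum>j<L. \<Sum>p=1..n. step_hell D i (a, j, p))"
      by (intro sum_mono step)
    finally show ?thesis by simp
  qed
  have "am.hell D i (\<lambda>_. c) (\<lambda>q. \<gamma> q L) =
      am.hell D i (\<lambda>_. c) (\<lambda>q. if q \<in> {1..n} then \<gamma> q L else c)"
    by (rule am.hell_cong) auto
  also have "\<dots> \<le> (\<Sum>a=1..n. am.hell D i (\<lambda>_. c) ((\<lambda>_. c)(a := \<gamma> a L)))"
    using am.hell_le_sum_upd[of "{1..n}" D i "\<lambda>_. c" "\<lambda>q. \<gamma> q L"] by simp
  also have "\<dots> \<le> (\<Sum>a=1..n. sqrt 2 * (\<Sum>j<L. \<Sum>p=1..n. step_hell D i (a, j, p)))"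
    by (intro sum_mono one)
  also have "\<dots> = sqrt 2 * (\<Sum>a=1..n. \<Sum>j<L. \<Sum>p=1..n. step_hell D i (a, j, p))"
    by (rule sum_distrib_left[symmetric])
  also have "(\<Sum>a=1..n. \<Sum>j<L. \<Sum>p=1..n. step_hell D i (a, j, p)) = (\<Sum>d\<in>dirs. step_hell D i d)"
    by (simp add: dirs_def sum.cartesian_product')
  finally show ?thesis .
qed

text \<open>Cauchy-Schwarz over the directions gives \<open>card dirs\<close>; 12 is the 6 of
  \<open>accept_diff_le\<close> times the square of sqrt 2.\<close>

lemma accept_prob_diff:
  "accept_prob D i (\<lambda>q. \<gamma> q L) - accept_prob D i (\<lambda>_. c) \<le>
     12 * card dirs * (\<Sum>d\<in>dirs. (step_hell D i d)\<^sup>2) + 1 / 6"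
proof -
  have "(am.hell D i (\<lambda>_. c) (\<lambda>q. \<gamma> q L))\<^sup>2 \<le> (sqrt 2 * (\<Sum>d\<in>dirs. step_hell D i d))\<^sup>2"
    by (intro power_mono hell_center_tips am.hell_nonneg)
  also have "\<dots> = 2 * (\<Sum>d\<in>dirs. step_hell D i d)\<^sup>2"
    by (simp add: power_mult_distrib)
  also have "\<dots> \<le> 2 * (card dirs * (\<Sum>d\<in>dirs. (step_hell D i d)\<^sup>2))"
    using sum_squared_le_sum_of_squares[of "step_hell D i" dirs] by (simp add: mult.commute)
  finally show ?thesis
    using am.accept_diff_le[of "{l \<in> transcripts P. verdict P l}" D i "\<lambda>q. \<gamma> q L" "\<lambda>_. c"]
    unfolding accept_prob_eq by simp
qed

text \<open>For fixed directions there is one relevant random bit per coordinate. On a leaf of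
  probability \<beta> the squared biases of these bits sum to at most 4 ln (1/\<beta>) by the
  level-one inequality; averaging over the leaves yields the entropy of the transcript, hence at
  most the cost.\<close>

lemma sum_step_hell:
  assumes D: "D \<in> dir_choices"
  shows "(\<Sum>i<K. (step_hell D i (D i))\<^sup>2) \<le> 8 * cost P"
proof -
  \<comment> \<open>\<open>pl i\<close> is the player whose bit matters at coordinate
    \<open>i\<close>; \<open>sg\<close> reads this bit and \<open>\<phi>\<close> toggles it.\<close>
  define pl where "pl i = snd (snd (D i))" for i
  have pl: "pl i \<in> {1..n}" if "i < K" for i
  proof -
    have "D i \<in> dirs" using D that by (auto simp: dir_choices_def)
    thus ?thesis by (auto simp: pl_def dirs_def)
  qed
  define sg :: "nat \<Rightarrow> (nat \<Rightarrow> nat set) \<Rightarrow> real" where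
    "sg i \<omega> = (if i \<in> \<omega> (pl i) then 1 else -1)" for i \<omega>
  define tog where "tog i A = (if i \<in> A then A - {i} else insert i A)" for i :: nat and A :: "nat set"
  define \<phi> :: "nat \<Rightarrow> (nat \<Rightarrow> nat set) \<Rightarrow> nat \<Rightarrow> nat set" where
    "\<phi> = (\<lambda>i \<omega>. fun_upd \<omega> (pl i) (tog i (\<omega> (pl i))))"
  have mem_\<phi>: "j \<in> \<phi> i \<omega> q \<longleftrightarrow> (if q = pl i \<and> j = i then j \<notin> \<omega> q else j \<in> \<omega> q)" for i j \<omega> q
    by (simp add: \<phi>_def tog_def)
  have \<phi>_in: "\<phi> i \<omega> \<in> \<Omega>" if i: "i < K" and \<omega>: "\<omega> \<in> \<Omega>" for i \<omega>
  proof -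
    have "\<omega> (pl i) \<subseteq> {..<K}"
      using \<omega> pl[OF i] by (auto simp: \<Omega>_def PiE_iff)
    hence "tog i (\<omega> (pl i)) \<in> Pow {..<K}"
      using i by (auto simp: tog_def)
    thus ?thesis
      using \<omega> pl[OF i] unfolding \<Omega>_def \<phi>_def by (metis PiE_fun_upd insert_absorb)
  qed
  have \<phi>_\<phi>: "\<phi> i (\<phi> i \<omega>) = \<omega>" for i \<omega>
    by (rule ext, rule set_eqI) (simp add: mem_\<phi>)
  interpret cube: sign_cube \<Omega> "{..<K}" sg \<phi>
    by unfold_locales (auto simp: finite_\<Omega> \<phi>_in \<phi>_\<phi> sg_def mem_\<phi>)
  define base where "base \<omega> q j = hybrid \<gamma> (D j) (j \<in> \<omega> q) q" for \<omega> q j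
  define S where "S l = {\<omega> \<in> \<Omega>. transcript P (inputs (base \<omega>)) = l}" for l
  define \<beta> where "\<beta> l = card (S l) / card \<Omega>" for l
  define N where "N = real (card \<Omega>)"
  have N: "N > 0" using card_\<Omega>_pos by (simp add: N_def)
  have fS: "finite (S l)" for l using finite_\<Omega> by (simp add: S_def)
  have SOm: "S l \<subseteq> \<Omega>" for l by (auto simp: S_def)
  \<comment> \<open>Planting the hybrid with bit \<open>b\<close> at \<open>i\<close> is the same as
    conditioning \<open>base\<close> on that bit being \<open>b\<close>, an event of probability
    1/2.\<close>
  have cond: "leaf_prob D i (hybrid \<gamma> (D i) b) l = 2 * (\<Sum>\<omega>\<in>S l. of_bool ((i \<in> \<omega> (pl i)) = b)) / N"
    if i: "i < K" for i b l
  proof -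
    define u where "u = hybrid \<gamma> (D i) b"
    define F :: "(nat \<Rightarrow> nat set) \<Rightarrow> real" where
      "F \<omega> = of_bool (transcript P (inputs (planted D i u \<omega>)) = l)" for \<omega>
    define s :: real where "s = (if b then 1 else -1)"
    have inv: "F (\<phi> i \<omega>) = F \<omega>" for \<omega>
    proof -
      have "planted D i u (\<phi> i \<omega>) = planted D i u \<omega>"
        by (intro ext) (simp add: planted_def mem_\<phi>)
      thus ?thesis by (simp add: F_def)
    qed
    have pb: "planted D i u \<omega> = base \<omega>" if "(i \<in> \<omega> (pl i)) = b" for \<omega>
    proof (intro ext)
      fix q j
      show "planted D i u \<omega> q j = base \<omega> q j"
        using that hybrid_indep[of q "D i" \<gamma> b "i \<in> \<omega> q"]
        by (cases "q = pl i") (auto simp: planted_def base_def u_def pl_def)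
    qed
    have "leaf_prob D i u l = (\<Sum>\<omega>\<in>\<Omega>. F \<omega>) / N"
      by (simp add: leaf_prob_def F_def N_def)
    also have "(\<Sum>\<omega>\<in>\<Omega>. F \<omega>) = 2 * (\<Sum>\<omega>\<in>\<Omega>. if sg i \<omega> = s then F \<omega> else 0)"
      by (rule cube.sum_flip_invariant) (use i inv in \<open>auto simp: s_def\<close>)
    also have "(\<Sum>\<omega>\<in>\<Omega>. if sg i \<omega> = s then F \<omega> else 0) =
        (\<Sum>\<omega>\<in>\<Omega>. if \<omega> \<in> S l then of_bool ((i \<in> \<omega> (pl i)) = b) else 0)"
      by (rule sum.cong) (auto simp: sg_def s_def F_def pb S_def)
    also have "\<dots> = (\<Sum>\<omega>\<in>S l. of_bool ((i \<in> \<omega> (pl i)) = b))"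
      using SOm[of l] finite_\<Omega> by (simp add: sum.If_cases Int_absorb1)
    finally show ?thesis by (simp add: u_def)
  qed
  \<comment> \<open>Here \<open>x + y\<close> is twice \<open>\<beta> l\<close>, and
    \<open>y - x\<close> is twice \<open>\<beta> l\<close> times the bias of the bit on
    \<open>S l\<close>.\<close>
  have term_le: "(am.amp D i (hybrid \<gamma> (D i) False) l - am.amp D i (hybrid \<gamma> (D i) True) l)\<^sup>2
      \<le> 2 * \<beta> l * ((\<Sum>\<omega>\<in>S l. sg i \<omega>) / card (S l))\<^sup>2"
    if i: "i < K" and l: "l \<in> transcripts P" for i l
  proof -
    define x where "x = leaf_prob D i (hybrid \<gamma> (D i) False) l"
    define y where "y = leaf_prob D i (hybrid \<gamma> (D i) True) l"
    have "x + y = 2 / N * (\<Sum>\<omega>\<in>S l. of_bool ((i \<in> \<omega> (pl i)) = False) + of_bool ((i \<in> \<omega> (pl i)) = True))"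
      unfolding x_def y_def cond[OF i] sum.distrib by (simp add: distrib_left)
    also have "(\<Sum>\<omega>\<in>S l. of_bool ((i \<in> \<omega> (pl i)) = False) + of_bool ((i \<in> \<omega> (pl i)) = True)) =
        (\<Sum>\<omega>\<in>S l. 1 :: real)"
      by (rule sum.cong) auto
    finally have xy: "x + y = 2 * card (S l) / N" by simp
    have "y - x = 2 / N * (\<Sum>\<omega>\<in>S l. of_bool ((i \<in> \<omega> (pl i)) = True) - of_bool ((i \<in> \<omega> (pl i)) = False))"
      unfolding x_def y_def cond[OF i] sum_subtractf by (simp add: right_diff_distrib)
    also have "(\<Sum>\<omega>\<in>S l. of_bool ((i \<in> \<omega> (pl i)) = True) - of_bool ((i \<in> \<omega> (pl i)) = False)) =
        (\<Sum>\<omega>\<in>S l. sg i \<omega>)"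
      by (rule sum.cong) (auto simp: sg_def)
    finally have yx: "y - x = 2 / N * (\<Sum>\<omega>\<in>S l. sg i \<omega>)" .
    have "(sqrt x - sqrt y)\<^sup>2 \<le> (y - x)\<^sup>2 / (x + y)"
      using sqrt_diff_square_le[of x y] by (simp add: x_def y_def leaf_prob_nonneg power2_commute)
    also have "\<dots> = 2 * \<beta> l * ((\<Sum>\<omega>\<in>S l. sg i \<omega>) / card (S l))\<^sup>2"
      unfolding xy yx using N
      by (cases "card (S l) = 0") (auto simp: \<beta>_def N_def[symmetric] field_simps power2_eq_square)
    finally show ?thesis by (simp add: amp_eq[OF l] x_def y_def)
  qed
  have per_leaf: "(\<Sum>i<K. (am.amp D i (hybrid \<gamma> (D i) False) l - am.amp D i (hybrid \<gamma> (D i) True) l)\<^sup>2)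
      \<le> 8 * (\<beta> l * ln (1 / \<beta> l))" if l: "l \<in> transcripts P" for l
  proof -
    have "(\<Sum>i<K. (am.amp D i (hybrid \<gamma> (D i) False) l - am.amp D i (hybrid \<gamma> (D i) True) l)\<^sup>2)
      \<le> (\<Sum>i<K. 2 * \<beta> l * ((\<Sum>\<omega>\<in>S l. sg i \<omega>) / card (S l))\<^sup>2)"
      by (intro sum_mono term_le l) auto
    also have "\<dots> = 2 * \<beta> l * (\<Sum>i<K. ((\<Sum>\<omega>\<in>S l. sg i \<omega>) / card (S l))\<^sup>2)"
      by (simp add: sum_distrib_left)
    also have "\<dots> \<le> 2 * \<beta> l * (4 * ln (1 / \<beta> l))"
    proof (cases "S l = {}")
      case False
      thus ?thesis
        using cube.level_one[OF SOm False] by (intro mult_left_mono) (auto simp: \<beta>_def)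
    qed (simp add: \<beta>_def)
    finally show ?thesis by simp
  qed
  have sum_\<beta>: "(\<Sum>l\<in>transcripts P. \<beta> l) = 1"
  proof -
    have "(\<Sum>l\<in>transcripts P. card (S l)) = card (\<Union>l\<in>transcripts P. S l)"
      by (rule card_UN_disjoint[symmetric]) (auto simp: finite_\<Omega> S_def)
    also have "(\<Union>l\<in>transcripts P. S l) = \<Omega>"
      by (auto simp: S_def transcript_in_transcripts)
    finally have "(\<Sum>l\<in>transcripts P. real (card (S l))) = N"
      unfolding N_def by (metis of_nat_sum)
    thus ?thesis using N by (simp add: \<beta>_def N_def[symmetric] sum_divide_distrib[symmetric])
  qed
  have "(\<Sum>i<K. (step_hell D i (D i))\<^sup>2) =
      (\<Sum>i<K. \<Sum>l\<in>transcripts P. (am.amp D i (hybrid \<gamma> (D i) False) l - am.amp D i (hybrid \<gamma> (D i) True) l)\<^sup>2)"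
    by (simp add: step_hell_def am.hell_def L2_set_def sum_nonneg)
  also have "\<dots> = (\<Sum>l\<in>transcripts P. \<Sum>i<K. (am.amp D i (hybrid \<gamma> (D i) False) l - am.amp D i (hybrid \<gamma> (D i) True) l)\<^sup>2)"
    by (rule sum.swap)
  also have "\<dots> \<le> (\<Sum>l\<in>transcripts P. 8 * (\<beta> l * ln (1 / \<beta> l)))"
    by (intro sum_mono per_leaf)
  also have "\<dots> = 8 * (\<Sum>l\<in>transcripts P. \<beta> l * ln (1 / \<beta> l))"
    by (simp add: sum_distrib_left)
  also have "\<dots> \<le> 8 * ln (card (transcripts P))"
    using sum_\<beta> by (intro mult_left_mono sum_entropy_le) (auto simp: \<beta>_def)
  also have "ln (card (transcripts P)) \<le> ln (2 ^ cost P)"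
  proof -
    have "transcripts P \<noteq> {}" using transcript_in_transcripts by blast
    hence "0 < card (transcripts P)" by (simp add: card_gt_0_iff)
    moreover have "real (card (transcripts P)) \<le> 2 ^ cost P"
      using card_transcripts[of P] by (metis of_nat_le_iff of_nat_numeral of_nat_power)
    ultimately show ?thesis by simp
  qed
  also have "ln (2 ^ cost P) = cost P * ln 2"
    by (simp add: ln_realpow)
  also have "\<dots> \<le> real (cost P) * 1"
    using ln_2_less_1 by (intro mult_left_mono) auto
  finally show ?thesis by simp
qed

text \<open>Of the average gap 1/3, \<open>accept_prob_diff\<close> consumes 1/6. The two factors
  \<open>card dirs\<close> come from Cauchy-Schwarz and from resampling the direction; 576 is 6
  times 12 times 8.\<close>

theorem distributional_bound:
  assumes gap: "(\<Sum>i<K. \<Sum>D\<in>dir_choices. accept_prob D i (\<lambda>q. \<gamma> q L) - accept_prob D i (\<lambda>_. c))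
      \<ge> K * card dir_choices / 3"
    and "dir_choices \<noteq> {}"
  shows "K \<le> 576 * (n\<^sup>2 * L)\<^sup>2 * cost P"
proof -
  define N where "N = real (card dir_choices)"
  define d where "d = real (card dirs)"
  have N: "N > 0" using assms(2) finite_dir_choices by (simp add: N_def card_gt_0_iff)
  have "K * N / 3 \<le> (\<Sum>i<K. \<Sum>D\<in>dir_choices. 12 * d * (\<Sum>e\<in>dirs. (step_hell D i e)\<^sup>2) + 1 / 6)"
  proof -
    have "K * N / 3 \<le> (\<Sum>i<K. \<Sum>D\<in>dir_choices. accept_prob D i (\<lambda>q. \<gamma> q L) - accept_prob D i (\<lambda>_. c))"
      using gap by (simp add: N_def)
    also have "\<dots> \<le> (\<Sum>i<K. \<Sum>D\<in>dir_choices. 12 * d * (\<Sum>e\<in>dirs. (step_hell D i e)\<^sup>2) + 1 / 6)"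
      using accept_prob_diff by (intro sum_mono) (simp add: d_def)
    finally show ?thesis .
  qed
  also have "\<dots> = 12 * d * (\<Sum>i<K. \<Sum>D\<in>dir_choices. \<Sum>e\<in>dirs. (step_hell D i e)\<^sup>2) + K * N / 6"
    by (simp add: sum.distrib sum_distrib_left N_def)
  also have "(\<Sum>i<K. \<Sum>D\<in>dir_choices. \<Sum>e\<in>dirs. (step_hell D i e)\<^sup>2) =
      (\<Sum>i<K. d * (\<Sum>D\<in>dir_choices. (step_hell D i (D i))\<^sup>2))"
    unfolding d_def by (intro sum.cong refl sum_dir_choices_resample) (auto simp: step_hell_upd)
  also have "\<dots> = d * (\<Sum>D\<in>dir_choices. \<Sum>i<K. (step_hell D i (D i))\<^sup>2)"
    by (subst sum.swap) (simp add: sum_distrib_left)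
  finally have "K * N / 3 \<le> 12 * d * (d * (\<Sum>D\<in>dir_choices. \<Sum>i<K. (step_hell D i (D i))\<^sup>2)) + K * N / 6" .
  moreover have "12 * d * (d * (\<Sum>D\<in>dir_choices. \<Sum>i<K. (step_hell D i (D i))\<^sup>2)) \<le>
      12 * d * (d * (\<Sum>D\<in>dir_choices. real (8 * cost P)))"
    by (intro mult_left_mono sum_mono) (use sum_step_hell in \<open>auto simp: d_def\<close>)
  moreover have "(\<Sum>D\<in>dir_choices. real (8 * cost P)) = N * (8 * cost P)"
    by (simp add: N_def)
  ultimately have "K * N / 6 \<le> 12 * d * (d * (N * (8 * cost P)))"
    by (simp only:)
  hence "K * N \<le> (576 * d\<^sup>2 * cost P) * N"
    by (simp add: power2_eq_square algebra_simps)
  hence "real K \<le> 576 * d\<^sup>2 * cost P" using N by simp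
  also have "\<dots> = real (576 * (n\<^sup>2 * L)\<^sup>2 * cost P)" by (simp add: d_def card_dirs)
  finally show ?thesis by (simp only: of_nat_le_iff)
qed

end

section \<open>From deterministic to randomized protocols\<close>

context star
begin

lemma planted_cases:
  assumes D: "D \<in> dir_choices" and j: "j < K" "j \<noteq> i"
  obtains a h where "a \<in> {1..n}" "h < L" "\<And>q. planted D i u \<omega> q j \<in> {\<gamma> a h, \<gamma> a (Suc h)}"
proof -
  obtain a h p where ahp: "D j = (a, h, p)" by (cases "D j")
  have "D j \<in> dirs" using D j by (auto simp: dir_choices_def)
  hence "a \<in> {1..n}" "h < L" by (auto simp: dirs_def ahp)
  thus ?thesis using that[of a h] j by (auto simp: planted_def hybrid_def ahp)
qed

text \<open>Averaging in the manner of Yao: planting the tips and planting the center give expected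
  acceptance at least 2/3 and at most 1/3, so some deterministic protocol has an average gap of at
  least 1/3.\<close>

theorem randomized_lower_bound:
  assumes R: "randomized_protocol n k R" and n: "n \<ge> 1" and L: "L \<ge> 1"
    and yes: "\<And>s. \<exists>i<K. (\<forall>q\<in>{1..n}. s q i = \<gamma> q L) \<and>
        (\<forall>j<K. j \<noteq> i \<longrightarrow> (\<exists>a\<in>{1..n}. \<exists>h<L. \<forall>q. s q j \<in> {\<gamma> a h, \<gamma> a (Suc h)})) \<Longrightarrow>
      measure R {P \<in> space R. outcome P (inputs s)} \<ge> 2 / 3"
    and no: "\<And>s. \<forall>j<K. \<exists>a\<in>{1..n}. \<exists>h<L. \<forall>q. s q j \<in> {\<gamma> a h, \<gamma> a (Suc h)} \<Longrightarrow>
      measure R {P \<in> space R. \<not> outcome P (inputs s)} \<ge> 2 / 3"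
  shows "K \<le> 576 * (n\<^sup>2 * L)\<^sup>2 * k"
proof (cases "K = 0")
  case False
  interpret R: prob_space R using R by (simp add: randomized_protocol_def)
  define X where "X = (SIGMA i:{..<K}. dir_choices \<times> \<Omega>)"
  define Y where "Y = (\<lambda>(i, D, \<omega>). inputs (planted D i (\<lambda>q. \<gamma> q L) \<omega>))"
  define Z where "Z = (\<lambda>(i, D, \<omega>). inputs (planted D i (\<lambda>_. c) \<omega>))"
  define \<Phi> :: "'x protocol \<Rightarrow> real" where
    "\<Phi> P = (\<Sum>x\<in>X. of_bool (outcome P (Y x)) - of_bool (outcome P (Z x)))" for P
  have fX: "finite X"
    by (simp add: X_def finite_dir_choices finite_\<Omega>)
  have cX: "card X = K * (card dir_choices * card \<Omega>)"
    by (simp add: X_def card_cartesian_product finite_dir_choices finite_\<Omega>)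
  have Y: "measure R {P \<in> space R. outcome P (Y x)} \<ge> 2 / 3" if x: "x \<in> X" for x
  proof -
    obtain i D \<omega> where x': "x = (i, D, \<omega>)" by (cases x)
    hence i: "i < K" and D: "D \<in> dir_choices" using x by (auto simp: X_def)
    show ?thesis
      unfolding x' Y_def prod.case
    proof (rule yes, intro exI[of _ i] conjI i allI impI ballI)
      fix j assume "j < K" "j \<noteq> i"
      from planted_cases[OF D this] show
        "\<exists>a\<in>{1..n}. \<exists>h<L. \<forall>q. planted D i (\<lambda>q. \<gamma> q L) \<omega> q j \<in> {\<gamma> a h, \<gamma> a (Suc h)}"
        by metis
    qed (simp add: planted_def)
  qed
  have Z: "measure R {P \<in> space R. \<not> outcome P (Z x)} \<ge> 2 / 3" if x: "x \<in> X" for x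
  proof -
    obtain i D \<omega> where x': "x = (i, D, \<omega>)" by (cases x)
    hence i: "i < K" and D: "D \<in> dir_choices" using x by (auto simp: X_def)
    show ?thesis
      unfolding x' Z_def prod.case
    proof (rule no, intro allI impI)
      fix j assume j: "j < K"
      show "\<exists>a\<in>{1..n}. \<exists>h<L. \<forall>q. planted D i (\<lambda>_. c) \<omega> q j \<in> {\<gamma> a h, \<gamma> a (Suc h)}"
      proof (cases "j = i")
        case True
        \<comment> \<open>The center is the start of leg 1, hence counts as lying on a step of
          it.\<close>
        show ?thesis
          by (rule bexI[of _ 1], rule exI[of _ 0]) (use n L True center in \<open>auto simp: planted_def\<close>)
      next
        case False
        from planted_cases[OF D j this] show ?thesis by metis
      qed
    qed
  qed
  \<comment> \<open>A nonmeasurable set has measure 0, so the success bound forces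
    measurability.\<close>
  have event: "{P \<in> space R. Q P} \<in> sets R" if "measure R {P \<in> space R. Q P} \<ge> 2 / 3" for Q
    using that measure_notin_sets[of "{P \<in> space R. Q P}" R] by force
  have int_Y: "integrable R (\<lambda>P. of_bool (outcome P (Y x)) :: real)"
    and exp_Y: "(\<integral>P. of_bool (outcome P (Y x)) \<partial>R) \<ge> (2 / 3 :: real)" if x: "x \<in> X" for x
  proof -
    have e: "{P \<in> space R. outcome P (Y x)} \<in> sets R" by (rule event[OF Y[OF x]])
    have eq: "indicator {P \<in> space R. outcome P (Y x)} P = (of_bool (outcome P (Y x)) :: real)"
      if "P \<in> space R" for P using that by auto
    show "integrable R (\<lambda>P. of_bool (outcome P (Y x)) :: real)"
      by (subst Bochner_Integration.integrable_cong[OF refl eq[symmetric]], assumption)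
        (rule integrable_real_indicator[OF e], simp add: less_top[symmetric])
    show "(\<integral>P. of_bool (outcome P (Y x)) \<partial>R) \<ge> (2 / 3 :: real)"
      using e Y[OF x] by (subst Bochner_Integration.integral_cong[OF refl eq[symmetric]]) auto
  qed
  have int_Z: "integrable R (\<lambda>P. of_bool (outcome P (Z x)) :: real)"
    and exp_Z: "(\<integral>P. of_bool (outcome P (Z x)) \<partial>R) \<le> (1 / 3 :: real)" if x: "x \<in> X" for x
  proof -
    have e': "{P \<in> space R. \<not> outcome P (Z x)} \<in> sets R" by (rule event[OF Z[OF x]])
    have co: "{P \<in> space R. outcome P (Z x)} = space R - {P \<in> space R. \<not> outcome P (Z x)}" by auto
    have e: "{P \<in> space R. outcome P (Z x)} \<in> sets R" unfolding co using e' by auto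
    have "measure R {P \<in> space R. outcome P (Z x)} \<le> 1 / 3"
      unfolding co using R.prob_compl[OF e'] Z[OF x] by simp
    have eq: "indicator {P \<in> space R. outcome P (Z x)} P = (of_bool (outcome P (Z x)) :: real)"
      if "P \<in> space R" for P using that by auto
    show "integrable R (\<lambda>P. of_bool (outcome P (Z x)) :: real)"
      by (subst Bochner_Integration.integrable_cong[OF refl eq[symmetric]], assumption)
        (rule integrable_real_indicator[OF e], simp add: less_top[symmetric])
    show "(\<integral>P. of_bool (outcome P (Z x)) \<partial>R) \<le> (1 / 3 :: real)"
      using e \<open>measure R {P \<in> space R. outcome P (Z x)} \<le> 1 / 3\<close>
      by (subst Bochner_Integration.integral_cong[OF refl eq[symmetric]]) auto
  qed
  have int: "integrable R \<Phi>"
    unfolding \<Phi>_def using int_Y int_Z by auto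
  have "(\<Sum>x\<in>X. 2 / 3 - 1 / 3) \<le>
      (\<Sum>x\<in>X. (\<integral>P. of_bool (outcome P (Y x)) \<partial>R) - (\<integral>P. of_bool (outcome P (Z x)) \<partial>R) :: real)"
    by (intro sum_mono diff_mono exp_Y exp_Z)
  also have "\<dots> = (\<integral>P. \<Phi> P \<partial>R)"
    unfolding \<Phi>_def using int_Y int_Z by (simp add: Bochner_Integration.integral_sum)
  finally have expectation: "card X / 3 \<le> (\<integral>P. \<Phi> P \<partial>R)" by simp
  obtain P where P: "P \<in> space R" "card X / 3 \<le> \<Phi> P"
  proof (rule ccontr)
    assume "\<not> thesis"
    hence "\<forall>P\<in>space R. \<Phi> P < card X / 3" using that by force
    hence "(\<integral>P. \<Phi> P \<partial>R) < card X / 3"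
      by (intro R.expectation_less[OF int] AE_I2) auto
    thus False using expectation by simp
  qed
  have sp: "speakers P \<subseteq> {1..n}" and cost: "cost P \<le> k"
    using R P by (auto simp: randomized_protocol_def)
  interpret star_protocol n K L \<gamma> c enc P
    by unfold_locales (rule sp)
  have ne: "dir_choices \<noteq> {}"
    using n L by (auto simp: dir_choices_def dirs_def PiE_eq_empty_iff lessThan_empty_iff)
  have accept_count: "card \<Omega> * accept_prob D i u =
      (\<Sum>\<omega>\<in>\<Omega>. of_bool (outcome P (inputs (planted D i u \<omega>))))" for D i u
    using card_\<Omega>_pos by (simp add: accept_prob_def)
  have "\<Phi> P = (\<Sum>i<K. \<Sum>D\<in>dir_choices. \<Sum>\<omega>\<in>\<Omega>. of_bool (outcome P (inputs (planted D i (\<lambda>q. \<gamma> q L) \<omega>))) -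
      of_bool (outcome P (inputs (planted D i (\<lambda>_. c) \<omega>))))"
    unfolding \<Phi>_def X_def Y_def Z_def
    by (simp add: sum.cartesian_product finite_dir_choices finite_\<Omega> split_def)
  also have "\<dots> = card \<Omega> * (\<Sum>i<K. \<Sum>D\<in>dir_choices. accept_prob D i (\<lambda>q. \<gamma> q L) - accept_prob D i (\<lambda>_. c))"
    unfolding sum_distrib_left right_diff_distrib accept_count by (simp add: sum_subtractf)
  finally have "card \<Omega> * (K * card dir_choices / 3) \<le>
      card \<Omega> * (\<Sum>i<K. \<Sum>D\<in>dir_choices. accept_prob D i (\<lambda>q. \<gamma> q L) - accept_prob D i (\<lambda>_. c))"
    using P(2) cX by (simp add: mult_ac)
  hence "K * card dir_choices / 3 \<le>
      (\<Sum>i<K. \<Sum>D\<in>dir_choices. accept_prob D i (\<lambda>q. \<gamma> q L) - accept_prob D i (\<lambda>_. c))"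
    using card_\<Omega>_pos by simp
  hence "K \<le> 576 * (n\<^sup>2 * L)\<^sup>2 * cost P"
    using ne by (rule distributional_bound)
  also have "\<dots> \<le> 576 * (n\<^sup>2 * L)\<^sup>2 * k"
    using cost by (rule mult_le_mono2)
  finally show ?thesis .
qed simp

end

section \<open>Self-dual covering valuations\<close>

text \<open>Inserting \<open>\<Lambda>\<close> caps the cost and gives a value to sets without a
  cover.\<close>

definition cover_cost :: "nat \<Rightarrow> 'i set \<Rightarrow> ('i \<Rightarrow> 'e set) \<Rightarrow> ('i \<Rightarrow> nat) \<Rightarrow> 'e set \<Rightarrow> nat" where
  "cover_cost \<Lambda> I D w X = Min (insert \<Lambda> (sum w ` {F. F \<subseteq> I \<and> X \<subseteq> \<Union> (D ` F)}))"

text \<open>By \<open>sparse\<close>, a set and its complement cannot both be covered for less than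
  \<open>\<Lambda>\<close>.\<close>

locale sparse_cover =
  fixes U :: "'e set" and I :: "'i set" and D :: "'i \<Rightarrow> 'e set" and w :: "'i \<Rightarrow> nat" and \<Lambda> :: nat
  assumes finite_I: "finite I"
    and sparse: "F \<subseteq> I \<Longrightarrow> U \<subseteq> \<Union> (D ` F) \<Longrightarrow> 2 * \<Lambda> \<le> sum w F"
begin

abbreviation g :: "'e set \<Rightarrow> nat" where
  "g \<equiv> cover_cost \<Lambda> I D w"

lemma finite_costs: "finite (insert \<Lambda> (sum w ` {F. F \<subseteq> I \<and> X \<subseteq> \<Union> (D ` F)}))"
  using finite_I by simp

lemma g_le: "g X \<le> \<Lambda>"
  unfolding cover_cost_def by (rule Min_le[OF finite_costs]) simp

lemma g_le_sum: "F \<subseteq> I \<Longrightarrow> X \<subseteq> \<Union> (D ` F) \<Longrightarrow> g X \<le> sum w F"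
  unfolding cover_cost_def by (rule Min_le[OF finite_costs]) auto

lemma g_attained:
  assumes "g X < \<Lambda>"
  obtains F where "F \<subseteq> I" "X \<subseteq> \<Union> (D ` F)" "sum w F = g X"
proof -
  have "g X \<in> insert \<Lambda> (sum w ` {F. F \<subseteq> I \<and> X \<subseteq> \<Union> (D ` F)})"
    unfolding cover_cost_def by (rule Min_in[OF finite_costs]) simp
  thus ?thesis using assms that by auto
qed

lemma g_mono: "X \<subseteq> Y \<Longrightarrow> g X \<le> g Y"
proof (cases "g Y < \<Lambda>")
  case True
  assume "X \<subseteq> Y"
  from True obtain F where "F \<subseteq> I" "Y \<subseteq> \<Union> (D ` F)" "sum w F = g Y" by (rule g_attained)
  thus ?thesis using g_le_sum[of F X] \<open>X \<subseteq> Y\<close> by auto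
next
  case False
  thus ?thesis using g_le[of X] by linarith
qed

lemma g_empty: "g {} = 0"
  using g_le_sum[of "{}" "{}"] by simp

lemma sum_Un_le:
  assumes "F \<subseteq> I" "G \<subseteq> I"
  shows "sum w (F \<union> G) \<le> sum w F + sum w G"
proof -
  have "finite F" "finite G" using assms finite_I finite_subset by auto
  thus ?thesis using sum.union_inter[of F G w] by linarith
qed

lemma g_Un: "g (X \<union> Y) \<le> g X + g Y"
proof (cases "g X < \<Lambda> \<and> g Y < \<Lambda>")
  case True
  then obtain F G where F: "F \<subseteq> I" "X \<subseteq> \<Union> (D ` F)" "sum w F = g X"
    and G: "G \<subseteq> I" "Y \<subseteq> \<Union> (D ` G)" "sum w G = g Y"
    using g_attained by metis
  have "g (X \<union> Y) \<le> sum w (F \<union> G)"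
    by (rule g_le_sum) (use F G in auto)
  thus ?thesis using sum_Un_le[of F G] F G by linarith
next
  case False
  thus ?thesis using g_le[of "X \<union> Y"] by linarith
qed

text \<open>The three optimal covers together form a cover of \<open>U\<close>.\<close>

lemma g_cover3:
  assumes "g X < \<Lambda>" "g Y < \<Lambda>" "g Z < \<Lambda>" "U \<subseteq> X \<union> Y \<union> Z"
  shows "2 * \<Lambda> \<le> g X + g Y + g Z"
proof -
  obtain F where F: "F \<subseteq> I" "X \<subseteq> \<Union> (D ` F)" "sum w F = g X" using assms(1) by (rule g_attained)
  obtain G where G: "G \<subseteq> I" "Y \<subseteq> \<Union> (D ` G)" "sum w G = g Y" using assms(2) by (rule g_attained)
  obtain H where H: "H \<subseteq> I" "Z \<subseteq> \<Union> (D ` H)" "sum w H = g Z" using assms(3) by (rule g_attained)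
  have "2 * \<Lambda> \<le> sum w (F \<union> G \<union> H)"
  proof (rule sparse)
    have "X \<union> Y \<union> Z \<subseteq> \<Union> (D ` (F \<union> G \<union> H))"
      using F(2) G(2) H(2) by (simp only: image_Un Union_Un_distrib) (intro Un_mono)
    thus "U \<subseteq> \<Union> (D ` (F \<union> G \<union> H))" using assms(4) by (rule order_trans[rotated])
  qed (use F G H in auto)
  also have "\<dots> \<le> sum w F + sum w G + sum w H"
    using sum_Un_le[of "F \<union> G" H] sum_Un_le[of F G] F(1) G(1) H(1) by simp
  finally show ?thesis by (simp only: F(3) G(3) H(3))
qed

lemma g_compl: "g X < \<Lambda> \<Longrightarrow> g (U - X) = \<Lambda>"
  using g_cover3[of X "{}" "U - X"] g_le[of "U - X"] g_empty by fastforce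

lemma g_U: "g U = \<Lambda>"
  using g_compl[of "{}"] g_empty g_le[of U] by fastforce

text \<open>The two-level function: cheaply covered sets keep their cover cost, complements of cheaply
  covered sets get the dual value, and every other set gets \<open>\<Lambda>\<close>.\<close>

definition f :: "'e set \<Rightarrow> real" where
  "f X = real \<Lambda> + real (g X) - real (g (U - X))"

lemma f_empty: "f {} = 0"
  by (simp add: f_def g_empty g_U)

lemma f_mono: "X \<subseteq> Y \<Longrightarrow> f X \<le> f Y"
  using g_mono[of X Y] g_mono[of "U - Y" "U - X", OF Diff_mono] by (simp add: f_def)

lemma f_nonneg: "f X \<ge> 0"
  using f_mono[of "{}" X] f_empty by simp

lemma f_dual: "X \<subseteq> U \<Longrightarrow> f X + f (U - X) = 2 * \<Lambda>"
  by (simp add: f_def double_diff)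

text \<open>The complement of \<open>X\<close> is covered by \<open>Y\<close> and the complement of
  \<open>X \<union> Y\<close>. So adding \<open>Y\<close> lowers the cost of the complement by at
  most \<open>g Y\<close>, and \<open>f Y\<close> is at least \<open>g Y\<close>.\<close>

lemma f_Un_aux:
  assumes X: "X \<subseteq> U" and Y: "Y \<subseteq> U" and c: "g (U - X) < \<Lambda>"
  shows "f (X \<union> Y) \<le> f X + f Y"
proof -
  have "g X = \<Lambda>" using g_compl[OF c] X by (simp add: double_diff)
  moreover have "g (U - X) \<le> g ((U - (X \<union> Y)) \<union> Y)" using Y by (intro g_mono) auto
  moreover have "g ((U - (X \<union> Y)) \<union> Y) \<le> g (U - (X \<union> Y)) + g Y" by (rule g_Un)
  ultimately show ?thesis
    using g_le[of "U - Y"] g_le[of "X \<union> Y"] by (simp add: f_def)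
qed

lemma f_Un:
  assumes X: "X \<subseteq> U" and Y: "Y \<subseteq> U"
  shows "f (X \<union> Y) \<le> f X + f Y"
proof (cases "g (U - X) < \<Lambda> \<or> g (U - Y) < \<Lambda>")
  case True
  thus ?thesis using f_Un_aux[of X Y] f_Un_aux[of Y X] X Y by (auto simp: Un_commute add.commute)
next
  case False
  hence c: "g (U - X) = \<Lambda>" "g (U - Y) = \<Lambda>" using g_le by (simp_all add: order_antisym)
  define W where "W = U - (X \<union> Y)"
  \<comment> \<open>If \<open>g W\<close> is \<open>\<Lambda>\<close>, this is subadditivity of
    \<open>g\<close>. Otherwise either \<open>X\<close> or \<open>Y\<close> costs
    \<open>\<Lambda>\<close> and the other one together with \<open>W\<close> covers a complement,
    or all three sets are cheap and \<open>g_cover3\<close> applies.\<close>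
  have "g (X \<union> Y) + \<Lambda> \<le> g X + g Y + g W"
  proof (cases "g W < \<Lambda>")
    case True
    have "\<Lambda> \<le> g Y + g W"
    proof -
      have "U - X \<subseteq> Y \<union> W" by (auto simp: W_def)
      thus ?thesis using g_mono[of "U - X" "Y \<union> W"] g_Un[of Y W] c by linarith
    qed
    moreover have "\<Lambda> \<le> g X + g W"
    proof -
      have "U - Y \<subseteq> X \<union> W" by (auto simp: W_def)
      thus ?thesis using g_mono[of "U - Y" "X \<union> W"] g_Un[of X W] c by linarith
    qed
    moreover have "2 * \<Lambda> \<le> g X + g Y + g W" if "g X < \<Lambda>" "g Y < \<Lambda>"
      by (rule g_cover3) (use that True in \<open>auto simp: W_def\<close>)
    ultimately show ?thesis
      using g_le[of "X \<union> Y"] by linarith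
  next
    case False
    thus ?thesis using g_Un[of X Y] by linarith
  qed
  hence "real (g (X \<union> Y)) + \<Lambda> \<le> real (g X) + g Y + g W"
    by (metis of_nat_add of_nat_le_iff)
  thus ?thesis using c by (simp add: f_def W_def)
qed

end

lemma capped_subadditive_valuation:
  assumes mono: "\<And>X Y. X \<subseteq> Y \<Longrightarrow> Y \<subseteq> {1..m} \<Longrightarrow> f X \<le> f Y"
    and nonneg: "\<And>X. f X \<ge> 0"
    and sub: "\<And>X Y. X \<subseteq> {1..m} \<Longrightarrow> Y \<subseteq> {1..m} \<Longrightarrow> f (X \<union> Y) \<le> f X + f Y"
  shows "(\<lambda>X\<in>Pow {1..m}. min 1 (f X)) \<in> subadditive_valuations m"
proof -
  have "(\<lambda>X\<in>Pow {1..m}. min 1 (f X)) \<in> valuations m"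
  proof -
    have "(\<lambda>X\<in>Pow {1..m}. min 1 (f X)) \<in> Pow {1..m} \<rightarrow>\<^sub>E {0..}"
      using nonneg by auto
    moreover have "mono_on (Pow {1..m}) (\<lambda>X\<in>Pow {1..m}. min 1 (f X))"
      using mono by (auto intro!: mono_onI min.mono simp del: min.bounded_iff)
    ultimately show ?thesis by (simp add: valuations_def)
  qed
  moreover have "min 1 (f (S \<union> T)) \<le> min 1 (f S) + min 1 (f T)" if "S \<subseteq> {1..m}" "T \<subseteq> {1..m}" for S T
    using sub[OF that] nonneg[of S] nonneg[of T] by (auto simp: min_def)
  ultimately show ?thesis by (auto simp: subadditive_valuations_def)
qed

text \<open>Item \<open>e\<close> belongs to part \<open>col i e\<close> of the \<open>i\<close>-th partition of the items into \<open>n\<close> parts.\<close>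

definition universal :: "nat \<Rightarrow> nat \<Rightarrow> nat \<Rightarrow> nat \<Rightarrow> (nat \<Rightarrow> nat \<Rightarrow> nat) \<Rightarrow> bool" where
  "universal m n K t col \<longleftrightarrow>
     (\<forall>F. F \<subseteq> {..<K} \<and> card F \<le> t \<longrightarrow>
        (\<forall>q\<in>F \<rightarrow> {1..n}. \<exists>e\<in>{1..m}. \<forall>i\<in>F. col i e = q i))"

text \<open>A word assigns to each partition \<open>i\<close> a part \<open>fst (s i)\<close>, which is promoted with strength
  \<open>snd (s i)\<close>: its complement can be covered at cost \<open>r\<^sup>2 - snd (s i)\<close>. All words of strength
  zero have the same meaning.\<close>

locale word_valuation =
  fixes m n K r :: nat and col :: "nat \<Rightarrow> nat \<Rightarrow> nat"
  assumes univ: "universal m n K (2 * r) col" and r: "r \<ge> 2"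
begin

definition support :: "(nat \<Rightarrow> nat \<times> nat) \<Rightarrow> nat set" where
  "support s = {i. i < K \<and> snd (s i) > 0}"

definition part_compl :: "(nat \<Rightarrow> nat \<times> nat) \<Rightarrow> nat \<Rightarrow> nat set" where
  "part_compl s i = {e \<in> {1..m}. col i e \<noteq> fst (s i)}"

definition weight :: "(nat \<Rightarrow> nat \<times> nat) \<Rightarrow> nat \<Rightarrow> nat" where
  "weight s i = r\<^sup>2 - snd (s i)"

text \<open>The bound on the strength keeps every weight at least \<open>r\<close>.\<close>

definition valid :: "(nat \<Rightarrow> nat \<times> nat) \<Rightarrow> bool" where
  "valid s \<longleftrightarrow> (\<forall>i<K. fst (s i) \<in> {1..n} \<and> snd (s i) \<le> r\<^sup>2 - r)"

lemma r_le_square: "r \<le> r\<^sup>2"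
  by (simp add: power2_eq_square)

lemma weight_ge: "valid s \<Longrightarrow> i < K \<Longrightarrow> r \<le> weight s i"
  using r_le_square unfolding valid_def weight_def by (metis diff_diff_cancel diff_le_mono2)

text \<open>Fewer than 2 r part complements miss an item common to the corresponding parts, and 2 r
  of them weigh at least 2 r^2.\<close>

lemma sparse_cover:
  assumes "valid s"
  shows "sparse_cover {1..m} (support s) (part_compl s) (weight s) (r\<^sup>2)"
proof
  show "finite (support s)" by (simp add: support_def)
  fix F assume F: "F \<subseteq> support s" and cov: "{1..m} \<subseteq> \<Union> (part_compl s ` F)"
  have FK: "F \<subseteq> {..<K}" using F by (auto simp: support_def)
  have "2 * r \<le> card F"
  proof (rule ccontr)
    assume "\<not> 2 * r \<le> card F"
    moreover have "(\<lambda>i. fst (s i)) \<in> F \<rightarrow> {1..n}" using assms FK by (auto simp: valid_def)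
    ultimately obtain e where "e \<in> {1..m}" "\<forall>i\<in>F. col i e = fst (s i)"
      using univ FK unfolding universal_def by (metis nat_le_linear)
    thus False using cov by (auto simp: part_compl_def)
  qed
  hence "2 * r\<^sup>2 \<le> card F * r" by (simp add: power2_eq_square)
  also have "\<dots> \<le> sum (weight s) F"
    using sum_bounded_below[of F r "weight s"] weight_ge[OF assms] FK by auto
  finally show "2 * r\<^sup>2 \<le> sum (weight s) F" .
qed

definition score :: "(nat \<Rightarrow> nat \<times> nat) \<Rightarrow> nat set \<Rightarrow> real" where
  "score s = sparse_cover.f {1..m} (support s) (part_compl s) (weight s) (r\<^sup>2)"

text \<open>A fully promoted part costs r^2 and its complement at most r, so its score reaches r^2 +
  r^2 - r.\<close>

definition full :: real where
  "full = 2 * (real r)\<^sup>2 - real r"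

text \<open>The cap at 1 keeps the welfare from exceeding \<open>n\<close>.\<close>

definition valuation_of :: "(nat \<Rightarrow> nat \<times> nat) \<Rightarrow> valuation" where
  "valuation_of s = (\<lambda>X\<in>Pow {1..m}. min 1 (score s X / full))"

lemma full_pos: "full > 0"
  using r by (simp add: full_def power2_eq_square algebra_simps)

lemma valuation_of_subadditive:
  assumes "valid s"
  shows "valuation_of s \<in> subadditive_valuations m"
proof -
  interpret sparse_cover "{1..m}" "support s" "part_compl s" "weight s" "r\<^sup>2"
    by (rule sparse_cover[OF assms])
  show ?thesis
    unfolding valuation_of_def
  proof (rule capped_subadditive_valuation)
    show "score s (X \<union> Y) / full \<le> score s X / full + score s Y / full"
      if "X \<subseteq> {1..m}" "Y \<subseteq> {1..m}" for X Y
      using f_Un[OF that] full_pos by (simp add: score_def add_divide_distrib[symmetric] divide_right_mono)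
  qed (use f_mono f_nonneg full_pos in \<open>auto simp: score_def divide_right_mono\<close>)
qed

text \<open>Strengths below 2 are exempt: near the center two words may name different parts, and a
  weight of at least r^2 - 1 is too large for the covers considered in
  \<open>cover_cost_adjacent\<close>.\<close>

definition adjacent :: "(nat \<Rightarrow> nat \<times> nat) \<Rightarrow> (nat \<Rightarrow> nat \<times> nat) \<Rightarrow> bool" where
  "adjacent s s' \<longleftrightarrow> (\<forall>i<K. snd (s i) \<ge> 2 \<longrightarrow> fst (s' i) = fst (s i) \<and> snd (s i) \<le> Suc (snd (s' i)))"

text \<open>A cover cheaper than r^2 - r has fewer than r sets, as each weighs at least r. All of
  them are available under \<open>s'\<close>, dearer by at most 1 each. For other sets the cap
  suffices.\<close>

lemma cover_cost_adjacent:
  assumes s: "valid s" and s': "valid s'" and adj: "adjacent s s'"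
  shows "cover_cost (r\<^sup>2) (support s') (part_compl s') (weight s') X \<le>
    cover_cost (r\<^sup>2) (support s) (part_compl s) (weight s) X + r"
proof -
  interpret S: sparse_cover "{1..m}" "support s" "part_compl s" "weight s" "r\<^sup>2"
    by (rule sparse_cover[OF s])
  interpret S': sparse_cover "{1..m}" "support s'" "part_compl s'" "weight s'" "r\<^sup>2"
    by (rule sparse_cover[OF s'])
  show ?thesis
  proof (cases "S.g X + r < r\<^sup>2")
    case True
    then obtain F where F: "F \<subseteq> support s" "X \<subseteq> \<Union> (part_compl s ` F)" "sum (weight s) F = S.g X"
      using S.g_attained[of X] by auto
    have FK: "F \<subseteq> {..<K}" using F by (auto simp: support_def)
    hence fin: "finite F" using finite_subset by blast
    have *: "i \<in> support s' \<and> part_compl s' i = part_compl s i \<and> weight s' i \<le> weight s i + 1"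
      if i: "i \<in> F" for i
    proof -
      have "weight s i \<le> sum (weight s) F" using fin i by (intro member_le_sum) auto
      hence "weight s i + r < r\<^sup>2" using F(3) True by linarith
      hence h: "snd (s i) \<ge> 2" using r by (simp add: weight_def)
      have iK: "i < K" using i FK by auto
      with adj h have "fst (s' i) = fst (s i)" "snd (s i) \<le> Suc (snd (s' i))"
        by (auto simp: adjacent_def)
      thus ?thesis using h iK by (auto simp: support_def part_compl_def weight_def)
    qed
    have "card F * r \<le> sum (weight s) F"
      using sum_bounded_below[of F r "weight s"] weight_ge[OF s] FK by auto
    also have "\<dots> < r * r" using F(3) True by (simp add: power2_eq_square)
    finally have cF: "card F < r" by simp
    have "S'.g X \<le> sum (weight s') F"
      by (rule S'.g_le_sum) (use * F in auto)
    also have "\<dots> \<le> (\<Sum>i\<in>F. weight s i + 1)"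
      by (rule sum_mono) (use * in auto)
    also have "\<dots> = S.g X + card F"
      using F(3) by (simp add: sum.distrib)
    finally show ?thesis using cF by linarith
  next
    case False
    thus ?thesis using S'.g_le[of X] by linarith
  qed
qed

text \<open>For a single word, monotonicity and self-duality give 2 r^2; exchanging \<open>s\<close>
  for \<open>s'\<close> shifts each of the two cover costs by at most r.\<close>

lemma score_disjoint:
  assumes s: "valid s" and s': "valid s'" and adj: "adjacent s s'" "adjacent s' s"
    and X: "X \<subseteq> {1..m}" and Y: "Y \<subseteq> {1..m}" and "X \<inter> Y = {}"
  shows "score s X + score s' Y \<le> 2 * r\<^sup>2 + 2 * r"
proof -
  interpret S: sparse_cover "{1..m}" "support s" "part_compl s" "weight s" "r\<^sup>2"
    by (rule sparse_cover[OF s])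
  interpret S': sparse_cover "{1..m}" "support s'" "part_compl s'" "weight s'" "r\<^sup>2"
    by (rule sparse_cover[OF s'])
  have "S'.f Y \<le> S'.f ({1..m} - X)"
    using assms by (intro S'.f_mono) auto
  also have "\<dots> = 2 * real (r\<^sup>2) - S'.f X"
    using S'.f_dual[OF X] by simp
  finally have "S.f X + S'.f Y \<le> 2 * real (r\<^sup>2) + (S.f X - S'.f X)" by simp
  also have "S.f X - S'.f X \<le> 2 * r"
  proof -
    have "real (S.g X) \<le> real (S'.g X) + r"
      using cover_cost_adjacent[OF s' s adj(2), of X] by (metis of_nat_add of_nat_le_iff)
    moreover have "real (S'.g ({1..m} - X)) \<le> real (S.g ({1..m} - X)) + r"
      using cover_cost_adjacent[OF s s' adj(1), of "{1..m} - X"] by (metis of_nat_add of_nat_le_iff)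
    ultimately show ?thesis by (simp add: S.f_def S'.f_def)
  qed
  finally show ?thesis by (simp add: score_def)
qed

lemma score_empty: "valid s \<Longrightarrow> score s {} = 0"
  unfolding score_def by (rule sparse_cover.f_empty[OF sparse_cover])

lemma valuation_of_promoted:
  assumes s: "valid s" and i: "i < K" and si: "s i = (q, r\<^sup>2 - r)"
  shows "valuation_of s {e \<in> {1..m}. col i e = q} = 1"
proof -
  interpret sparse_cover "{1..m}" "support s" "part_compl s" "weight s" "r\<^sup>2"
    by (rule sparse_cover[OF s])
  define T where "T = {e \<in> {1..m}. col i e = q}"
  have compl: "{1..m} - T = part_compl s i"
    by (auto simp: T_def part_compl_def si)
  have "r * 2 \<le> r * r" using r by (intro mult_le_mono2) auto
  hence r2: "r < r\<^sup>2" using r unfolding power2_eq_square by linarith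
  have "g ({1..m} - T) \<le> sum (weight s) {i}"
    by (rule g_le_sum) (use i r2 in \<open>auto simp: compl support_def si\<close>)
  also have "\<dots> = r" using r2 by (simp add: weight_def si)
  finally have g: "g ({1..m} - T) \<le> r" .
  have T: "T \<subseteq> {1..m}" by (auto simp: T_def)
  have "g T = r\<^sup>2" using g_compl[of "{1..m} - T"] g r2 T by (simp add: double_diff)
  hence "score s T \<ge> full"
    using g by (simp add: score_def f_def full_def)
  hence "1 \<le> score s T / full" using full_pos by simp
  thus ?thesis using T unfolding valuation_of_def T_def[symmetric] by simp
qed

end

section \<open>Universal families of partitions\<close>

text \<open>A union bound by counting: a random item lies in t prescribed parts with probability
  1/n^t, so all m items miss them with probability (1 - 1/n^t)^m, and there are at most (K n)^t
  prescriptions.\<close>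

lemma universal_exists:
  assumes tK: "t \<le> K" and n: "n \<ge> 1"
    and bound: "(real K * real n) ^ t * (1 - 1 / real n ^ t) ^ m < 1"
  shows "\<exists>col. universal m n K t col"
proof -
  \<comment> \<open>An element of \<open>W\<close> lists the parts containing one item;
    \<open>bad\<close> collects the families in which no item fits the prescription.\<close>
  define W where "W = {..<K} \<rightarrow>\<^sub>E {1..n}"
  define fits where "fits F q = {x \<in> W. \<forall>i\<in>F. x i = q i}" for F and q :: "nat \<Rightarrow> nat"
  define \<F> where "\<F> = {F. F \<subseteq> {..<K} \<and> card F = t}"
  define Q where "Q = (SIGMA F:\<F>. F \<rightarrow>\<^sub>E {1..n})"
  define bad where "bad = (\<lambda>(F, q). {1..m} \<rightarrow>\<^sub>E (W - fits F q))"
  have finW: "finite W" by (simp add: W_def finite_PiE)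
  have cW: "card W = n ^ K" by (simp add: W_def card_PiE)
  have fin\<F>: "finite \<F>" by (simp add: \<F>_def)
  have finF: "finite F" "F \<subseteq> {..<K}" "card F = t" if "F \<in> \<F>" for F
    using that finite_subset[of F "{..<K}"] by (auto simp: \<F>_def)
  have finQ: "finite Q" unfolding Q_def using fin\<F> finF by (auto intro!: finite_PiE)
  have cQ: "card Q \<le> (K * n) ^ t"
  proof -
    have "card Q = (\<Sum>F\<in>\<F>. card (F \<rightarrow>\<^sub>E {1..n}))"
      unfolding Q_def using fin\<F> finF by (intro card_SigmaI) (auto intro!: finite_PiE)
    also have "\<dots> = (\<Sum>F\<in>\<F>. n ^ t)"
      by (rule sum.cong) (auto simp: card_PiE finF)
    also have "\<dots> = (K choose t) * n ^ t"
      using n_subsets[of "{..<K}" t] by (simp add: \<F>_def)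
    also have "\<dots> \<le> K ^ t * n ^ t"
      using binomial_le_pow[OF tK] by simp
    finally show ?thesis by (simp add: power_mult_distrib)
  qed
  have cfits: "card (fits F q) = n ^ (K - t)" if Fq: "(F, q) \<in> Q" for F q
  proof -
    have F: "F \<in> \<F>" and q: "\<And>i. i \<in> F \<Longrightarrow> q i \<in> {1..n}" using Fq by (auto simp: Q_def)
    have "fits F q = (\<Pi>\<^sub>E i\<in>{..<K}. if i \<in> F then {q i} else {1..n})"
    proof (intro equalityI subsetI)
      fix x assume "x \<in> fits F q"
      thus "x \<in> (\<Pi>\<^sub>E i\<in>{..<K}. if i \<in> F then {q i} else {1..n})"
        by (simp add: fits_def W_def PiE_iff)
    next
      fix x assume x: "x \<in> (\<Pi>\<^sub>E i\<in>{..<K}. if i \<in> F then {q i} else {1..n})"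
      have "x i = q i" if "i \<in> F" for i
        using PiE_mem[OF x, of i] that finF(2)[OF F] by auto
      moreover have "x i \<in> {1..n}" if "i < K" for i
      proof (cases "i \<in> F")
        case True
        thus ?thesis using PiE_mem[OF x, of i] q[of i] that by simp
      next
        case False
        thus ?thesis using PiE_mem[OF x, of i] that by simp
      qed
      moreover have "x \<in> extensional {..<K}" using x by (simp only: PiE_iff)
      ultimately show "x \<in> fits F q" by (simp add: fits_def W_def PiE_iff)
    qed
    hence "card (fits F q) = (\<Prod>i<K. if i \<in> F then 1 else n)"
      by (simp add: card_PiE if_distrib One_nat_def cong: if_cong)
    also have "\<dots> = n ^ card ({..<K} - F)"
      by (simp add: prod.If_cases Diff_eq)
    also have "card ({..<K} - F) = K - t"
      using finF[OF F] by (simp add: card_Diff_subset)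
    finally show ?thesis .
  qed
  have fitsW: "fits F q \<subseteq> W" for F q by (auto simp: fits_def)
  have "card (\<Union>x\<in>Q. bad x) \<le> (\<Sum>x\<in>Q. card (bad x))"
    by (rule card_UN_le[OF finQ])
  also have "\<dots> = (\<Sum>x\<in>Q. (n ^ K - n ^ (K - t)) ^ m)"
  proof (rule sum.cong)
    fix x assume "x \<in> Q"
    then obtain F q where x: "x = (F, q)" and Fq: "(F, q) \<in> Q" by (cases x) auto
    have "card (W - fits F q) = n ^ K - n ^ (K - t)"
      using finW fitsW by (simp add: card_Diff_subset finite_subset[OF fitsW] cW cfits[OF Fq])
    thus "card (bad x) = (n ^ K - n ^ (K - t)) ^ m"
      by (simp add: bad_def x card_PiE)
  qed simp
  also have "\<dots> \<le> (K * n) ^ t * (n ^ K - n ^ (K - t)) ^ m"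
    using cQ by simp
  also have "\<dots> < (n ^ K) ^ m"
  proof -
    have "n ^ (K - t) \<le> n ^ K" using n by (intro power_increasing) auto
    hence "real (n ^ K - n ^ (K - t)) = real n ^ K - real n ^ (K - t)"
      by (simp add: of_nat_diff)
    also have "\<dots> = real n ^ K * (1 - 1 / real n ^ t)"
      using tK n by (simp add: right_diff_distrib power_diff)
    finally have eq: "real (n ^ K - n ^ (K - t)) = real n ^ K * (1 - 1 / real n ^ t)" .
    have "real ((K * n) ^ t * (n ^ K - n ^ (K - t)) ^ m) =
        ((real K * real n) ^ t * (1 - 1 / real n ^ t) ^ m) * (real n ^ K) ^ m"
      unfolding of_nat_mult of_nat_power eq power_mult_distrib by simp
    also have "\<dots> < 1 * (real n ^ K) ^ m"
      using bound n by (intro mult_strict_right_mono) auto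
    finally show ?thesis by (metis mult_1 of_nat_less_iff of_nat_power)
  qed
  also have "\<dots> = card ({1..m} \<rightarrow>\<^sub>E W)"
    by (simp add: card_PiE cW)
  finally have "card (\<Union>x\<in>Q. bad x) < card ({1..m} \<rightarrow>\<^sub>E W)" .
  moreover have "finite (\<Union>x\<in>Q. bad x)"
    using finQ finW by (auto simp: bad_def intro!: finite_PiE)
  ultimately obtain x where x: "x \<in> {1..m} \<rightarrow>\<^sub>E W" "x \<notin> (\<Union>x\<in>Q. bad x)"
    by (metis card_mono leD subsetI)
  have "universal m n K t (\<lambda>i e. x e i)"
    unfolding universal_def
  proof (intro allI impI ballI)
    fix F q assume F: "F \<subseteq> {..<K} \<and> card F \<le> t" and q: "q \<in> F \<rightarrow> {1..n}"
    \<comment> \<open>Smaller sets are padded to size \<open>t\<close>, with the arbitrary part 1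
      prescribed on the new partitions.\<close>
    obtain G where G: "F \<subseteq> G" "G \<subseteq> {..<K}" "card G = t"
      using exists_subset_between[of F t "{..<K}"] F tK by auto
    define p where "p = (\<lambda>i\<in>G. if i \<in> F then q i else 1)"
    have "(G, p) \<in> Q" using G q n by (auto simp: Q_def \<F>_def p_def)
    hence "x \<notin> {1..m} \<rightarrow>\<^sub>E (W - fits G p)" using x(2) by (auto simp: bad_def)
    then obtain e where e: "e \<in> {1..m}" "x e \<in> fits G p"
      using x(1) by (auto simp: PiE_iff)
    hence "\<forall>i\<in>F. x e i = q i" using G(1) by (auto simp: fits_def p_def)
    thus "\<exists>e\<in>{1..m}. \<forall>i\<in>F. x e i = q i" using e by blast
  qed
  thus ?thesis by blast
qed

section \<open>The two kinds of instances\<close>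

text \<open>At most one term exceeds B/2; it is paired with any other term.\<close>

lemma sum_le_of_pairwise_sum_le:
  fixes x :: "'a \<Rightarrow> real" and B :: real
  assumes S: "finite S" "card S \<ge> 2"
    and pair: "\<And>p q. p \<in> S \<Longrightarrow> q \<in> S \<Longrightarrow> p \<noteq> q \<Longrightarrow> x p + x q \<le> B"
  shows "(\<Sum>p\<in>S. x p) \<le> card S * B / 2"
proof (cases "\<exists>p\<in>S. x p > B / 2")
  case True
  then obtain p where p: "p \<in> S" "x p > B / 2" by blast
  have "card (S - {p}) \<ge> 1" using S p by (simp add: card_Diff_singleton)
  hence "S - {p} \<noteq> {}" by (metis card.empty not_one_le_zero)
  then obtain q where q: "q \<in> S" "q \<noteq> p" by blast
  have "(\<Sum>i\<in>S. x i) = x p + x q + (\<Sum>i\<in>S - {p} - {q}. x i)"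
    using S p q by (simp add: sum.remove[of S p] sum.remove[of "S - {p}" q])
  also have "(\<Sum>i\<in>S - {p} - {q}. x i) \<le> (\<Sum>i\<in>S - {p} - {q}. B / 2)"
  proof (rule sum_mono)
    fix i assume "i \<in> S - {p} - {q}"
    thus "x i \<le> B / 2" using pair[of p i] p by auto
  qed
  also have "\<dots> = (real (card S) - 2) * (B / 2)"
    using S p q by (simp add: card_Diff_singleton of_nat_diff)
  finally show ?thesis using pair[of p q] p q by (simp add: algebra_simps)
next
  case False
  hence "(\<Sum>p\<in>S. x p) \<le> (\<Sum>p\<in>S. B / 2)" by (intro sum_mono) force
  thus ?thesis by simp
qed

lemma finite_allocations: "finite (allocations n m)"
proof (rule finite_subset)
  show "allocations n m \<subseteq> {1..n} \<rightarrow>\<^sub>E Pow {1..m}" by (auto simp: allocations_def)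
qed (simp add: finite_PiE)

lemma max_welfare_eqI:
  assumes "A \<in> allocations n m" "welfare n f A = z"
    and "\<And>B. B \<in> allocations n m \<Longrightarrow> welfare n f B \<le> z"
  shows "max_welfare n m f = z"
  unfolding max_welfare_def using assms finite_allocations[of n m] by (intro Max_eqI) auto

context word_valuation
begin

text \<open>Strength zero is always written as (1, 0), so that all legs start at literally the same
  point.\<close>

definition leg :: "nat \<Rightarrow> nat \<Rightarrow> nat \<times> nat" where
  "leg a h = (if h = 0 then (1, 0) else (a, h))"

lemma near_adjacent:
  assumes "\<forall>j<K. \<exists>a\<in>{1..n}. \<exists>h<L. \<forall>q. s q j \<in> {leg a h, leg a (Suc h)}"
  shows "adjacent (s p) (s q)"
  unfolding adjacent_def
proof (intro allI impI)
  fix j assume j: "j < K" and h2: "2 \<le> snd (s p j)"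
  obtain a h where "s p j \<in> {leg a h, leg a (Suc h)}" "s q j \<in> {leg a h, leg a (Suc h)}"
    using assms j by meson
  thus "fst (s q j) = fst (s p j) \<and> snd (s p j) \<le> Suc (snd (s q j))"
    using h2 by (auto simp: leg_def split: if_splits)
qed

lemma leg_valid: "a \<in> {1..n} \<Longrightarrow> h \<le> r\<^sup>2 - r \<Longrightarrow> fst (leg a h) \<in> {1..n} \<and> snd (leg a h) \<le> r\<^sup>2 - r"
  by (auto simp: leg_def)

lemma near_valid:
  assumes "j < K" "\<exists>a\<in>{1..n}. \<exists>h<r\<^sup>2 - r. \<forall>q. s q j \<in> {leg a h, leg a (Suc h)}"
  shows "fst (s q j) \<in> {1..n} \<and> snd (s q j) \<le> r\<^sup>2 - r"
proof -
  obtain a h where "a \<in> {1..n}" "h < r\<^sup>2 - r" "s q j \<in> {leg a h, leg a (Suc h)}"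
    using assms by meson
  thus ?thesis using leg_valid[of a h] leg_valid[of a "Suc h"] by auto
qed

lemma must_output_one_promoted:
  assumes valid: "\<And>q. q \<in> {1..n} \<Longrightarrow> valid (s q)" and i: "i < K"
    and tips: "\<forall>q\<in>{1..n}. s q i = (q, r\<^sup>2 - r)"
  shows "must_output_one n m (\<lambda>q\<in>{1..n}. valuation_of (s q))"
  unfolding must_output_one_def
proof (rule max_welfare_eqI)
  define A where "A = (\<lambda>q\<in>{1..n}. {e \<in> {1..m}. col i e = q})"
  show "A \<in> allocations n m"
    by (auto simp: allocations_def A_def disjoint_family_on_def)
  show "welfare n (\<lambda>q\<in>{1..n}. valuation_of (s q)) A = real n"
    unfolding welfare_def A_def
    using valuation_of_promoted[OF valid i] tips by simp
  fix B assume B: "B \<in> allocations n m"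
  have "welfare n (\<lambda>q\<in>{1..n}. valuation_of (s q)) B \<le> (\<Sum>q\<in>{1..n}. 1)"
    unfolding welfare_def
  proof (rule sum_mono)
    fix q assume "q \<in> {1..n}"
    moreover from this have "B q \<subseteq> {1..m}" using B by (auto simp: allocations_def)
    ultimately show "(\<lambda>q\<in>{1..n}. valuation_of (s q)) q (B q) \<le> 1"
      by (simp add: valuation_of_def)
  qed
  thus "welfare n (\<lambda>q\<in>{1..n}. valuation_of (s q)) B \<le> real n" by simp
qed

text \<open>The ratio for t \<ge> 2 is \<open>full\<close> divided by r^2 + r, half of the pair
  bound in \<open>score_disjoint\<close>; so t bidders get at most t times half the pair bound. For
  t = 1 the cap suffices.\<close>

lemma must_output_zero_adjacent:
  assumes valid: "\<And>q. q \<in> {1..n} \<Longrightarrow> valid (s q)"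
    and adj: "\<And>p q. adjacent (s p) (s q)"
    and \<alpha>1: "\<alpha> 1 = 1" and \<alpha>: "\<And>t. t \<ge> 2 \<Longrightarrow> \<alpha> t = (2 * real r - 1) / (real r + 1)"
  shows "must_output_zero n m \<alpha> (\<lambda>q\<in>{1..n}. valuation_of (s q))"
  unfolding must_output_zero_def
proof (intro ballI notI)
  fix t assume t: "t \<in> {1..n}"
  define B where "B = 2 * (real r + 1) / (2 * real r - 1)"
  have rpos: "2 * real r - 1 > 0" using r by linarith
  have B1: "B \<ge> 1" using rpos by (simp add: B_def field_simps)
  assume "\<exists>A\<in>allocations n m. scarce n t A \<and>
    welfare n (\<lambda>q\<in>{1..n}. valuation_of (s q)) A > real t / \<alpha> t"
  then obtain A where A: "A \<in> allocations n m" and sc: "scarce n t A"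
    and large: "welfare n (\<lambda>q\<in>{1..n}. valuation_of (s q)) A > real t / \<alpha> t" by blast
  have Asub: "A q \<subseteq> {1..m}" if "q \<in> {1..n}" for q
    using A that by (auto simp: allocations_def)
  define x where "x q = min 1 (score (s q) (A q) / full)" for q
  define S where "S = {q \<in> {1..n}. A q \<noteq> {}}"
  have cS: "card S \<le> t" using sc by (simp add: scarce_def S_def)
  have "welfare n (\<lambda>q\<in>{1..n}. valuation_of (s q)) A = (\<Sum>q\<in>{1..n}. x q)"
    unfolding welfare_def by (rule sum.cong) (use Asub in \<open>auto simp: valuation_of_def x_def\<close>)
  also have "\<dots> = (\<Sum>q\<in>S. x q)"
    by (rule sum.mono_neutral_right) (auto simp: S_def x_def score_empty valid)
  finally have welfare: "welfare n (\<lambda>q\<in>{1..n}. valuation_of (s q)) A = (\<Sum>q\<in>S. x q)" .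
  have bound: "(\<Sum>q\<in>S. x q) \<le> card S" using sum_bounded_above[of S x 1] by (simp add: x_def)
  have pair: "x p + x q \<le> B" if p: "p \<in> S" and q: "q \<in> S" and "p \<noteq> q" for p q
  proof -
    have pn: "p \<in> {1..n}" and qn: "q \<in> {1..n}" using p q by (auto simp: S_def)
    have "A p \<inter> A q = {}"
      using A pn qn \<open>p \<noteq> q\<close> by (auto simp: allocations_def disjoint_family_on_def)
    hence le: "score (s p) (A p) + score (s q) (A q) \<le> 2 * r\<^sup>2 + 2 * r"
      using score_disjoint[of "s p" "s q" "A p" "A q"] valid adj Asub pn qn by auto
    have "x p + x q \<le> score (s p) (A p) / full + score (s q) (A q) / full"
      by (simp add: x_def add_mono)
    also have "\<dots> \<le> (2 * r\<^sup>2 + 2 * r) / full"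
      using le full_pos by (simp add: add_divide_distrib[symmetric] divide_right_mono)
    also have "\<dots> = B"
      using r rpos by (simp add: B_def full_def power2_eq_square field_simps)
    finally show ?thesis .
  qed
  have "(\<Sum>q\<in>S. x q) \<le> real t / \<alpha> t"
  proof (cases "t = 1")
    case True
    thus ?thesis using bound cS \<alpha>1 by simp
  next
    case False
    hence t2: "t \<ge> 2" using t by auto
    have \<alpha>t: "real t / \<alpha> t = real t * B / 2"
      unfolding \<alpha>[OF t2] using rpos by (simp add: B_def field_simps)
    show ?thesis
    proof (cases "card S \<ge> 2")
      case True
      have "(\<Sum>q\<in>S. x q) \<le> card S * B / 2"
        by (rule sum_le_of_pairwise_sum_le) (use True pair in \<open>auto simp: S_def\<close>)
      also have "\<dots> \<le> real t * B / 2"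
        using cS B1 by (intro divide_right_mono mult_right_mono) auto
      finally show ?thesis by (simp add: \<alpha>t)
    next
      case False
      \<comment> \<open>With at most one bidder served, the cap and \<open>B1\<close> suffice since
        t \<ge> 2.\<close>
      hence "(\<Sum>q\<in>S. x q) \<le> 1" using bound by linarith
      also have "\<dots> \<le> real t * B / 2"
        using mult_mono[of 2 "real t" 1 B] t2 B1 by simp
      finally show ?thesis by (simp add: \<alpha>t)
    qed
  qed
  thus False using large welfare by simp
qed

theorem protocol_lower_bound:
  assumes n: "n \<ge> 1" and R: "randomized_protocol n k R"
    and solves: "solves_gap_welfare n m (subadditive_valuations m) \<alpha> R"
    and \<alpha>1: "\<alpha> 1 = 1" and \<alpha>: "\<And>t. t \<ge> 2 \<Longrightarrow> \<alpha> t = (2 * real r - 1) / (real r + 1)"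
  shows "K \<le> 576 * (n\<^sup>2 * (r\<^sup>2 - r))\<^sup>2 * k"
proof -
  interpret star n K "r\<^sup>2 - r" leg "(1, 0)" valuation_of
    by unfold_locales (simp add: leg_def)
  have "r * 2 \<le> r * r" using r by (intro mult_le_mono2) auto
  hence L: "r\<^sup>2 - r \<ge> 1" using r unfolding power2_eq_square by linarith
  have in_class: "inputs s \<in> {1..n} \<rightarrow>\<^sub>E subadditive_valuations m"
    if "\<And>q. q \<in> {1..n} \<Longrightarrow> valid (s q)" for s
    unfolding inputs_def using that valuation_of_subadditive by auto
  show ?thesis
  proof (rule randomized_lower_bound[OF R n L])
    fix s :: "nat \<Rightarrow> nat \<Rightarrow> nat \<times> nat"
    assume "\<exists>i<K. (\<forall>q\<in>{1..n}. s q i = leg q (r\<^sup>2 - r)) \<and>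
      (\<forall>j<K. j \<noteq> i \<longrightarrow> (\<exists>a\<in>{1..n}. \<exists>h<r\<^sup>2 - r. \<forall>q. s q j \<in> {leg a h, leg a (Suc h)}))"
    then obtain i where i: "i < K" and tips: "\<forall>q\<in>{1..n}. s q i = leg q (r\<^sup>2 - r)"
      and near: "\<forall>j<K. j \<noteq> i \<longrightarrow> (\<exists>a\<in>{1..n}. \<exists>h<r\<^sup>2 - r. \<forall>q. s q j \<in> {leg a h, leg a (Suc h)})"
      by blast
    have valid: "valid (s q)" if q: "q \<in> {1..n}" for q
      unfolding valid_def
    proof (intro allI impI)
      fix j assume "j < K"
      thus "fst (s q j) \<in> {1..n} \<and> snd (s q j) \<le> r\<^sup>2 - r"
        using near near_valid[of j s q] tips leg_valid[of q "r\<^sup>2 - r"] q by (cases "j = i") auto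
    qed
    have "must_output_one n m (inputs s)"
      unfolding inputs_def
      by (rule must_output_one_promoted[OF valid i]) (use tips L in \<open>auto simp: leg_def\<close>)
    thus "2 / 3 \<le> measure R {P \<in> space R. outcome P (inputs s)}"
      using solves in_class[of s] valid by (simp add: solves_gap_welfare_def)
  next
    fix s :: "nat \<Rightarrow> nat \<Rightarrow> nat \<times> nat"
    assume near: "\<forall>j<K. \<exists>a\<in>{1..n}. \<exists>h<r\<^sup>2 - r. \<forall>q. s q j \<in> {leg a h, leg a (Suc h)}"
    have valid: "valid (s q)" for q
      unfolding valid_def using near near_valid[of _ s q] by blast
    have "must_output_zero n m \<alpha> (inputs s)"
      unfolding inputs_def
      by (intro must_output_zero_adjacent valid near_adjacent[OF near] \<alpha>1 \<alpha>)
    thus "2 / 3 \<le> measure R {P \<in> space R. \<not> outcome P (inputs s)}"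
      using solves in_class[of s] valid by (simp add: solves_gap_welfare_def)
  qed
qed

end

section \<open>Choice of parameters\<close>

text \<open>The threshold \<open>t / \<alpha> t\<close> equals \<open>n\<close> for every t, so one
  instance demands both answers and no protocol solves the problem.\<close>

lemma strongly_inapproximable_conflict:
  assumes n: "n \<ge> 1" and \<alpha>: "\<And>t. \<alpha> t = real t / real n"
  shows "strongly_inapproximable n m (subadditive_valuations m) \<alpha> z"
  unfolding strongly_inapproximable_def
proof (intro allI impI, elim conjE)
  fix k R assume R: "randomized_protocol n k R"
    and solves: "solves_gap_welfare n m (subadditive_valuations m) \<alpha> R"
  interpret prob_space R using R by (simp add: randomized_protocol_def)
  \<comment> \<open>Being 1 on the empty set too, these valuations give every allocation welfare
    exactly \<open>n\<close>.\<close>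
  define f :: "nat \<Rightarrow> valuation" where "f = (\<lambda>i\<in>{1..n}. \<lambda>X\<in>Pow {1..m}. 1)"
  have w: "welfare n f A = n" if "A \<in> allocations n m" for A
  proof -
    have "welfare n f A = (\<Sum>i\<in>{1..n}. 1)"
      unfolding welfare_def by (rule sum.cong) (use that in \<open>auto simp: f_def allocations_def\<close>)
    thus ?thesis by simp
  qed
  have "(\<lambda>X\<in>Pow {1..m}. 1) \<in> subadditive_valuations m"
    using capped_subadditive_valuation[of m "\<lambda>_. 1"] by simp
  hence f: "f \<in> {1..n} \<rightarrow>\<^sub>E subadditive_valuations m"
    by (auto simp: f_def)
  have empty: "(\<lambda>i\<in>{1..n}. {}) \<in> allocations n m"
    by (auto simp: allocations_def disjoint_family_on_def)
  have "must_output_one n m f"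
    unfolding must_output_one_def by (rule max_welfare_eqI[OF empty w[OF empty]]) (simp add: w)
  hence one: "prob {P \<in> space R. outcome P f} \<ge> 2 / 3"
    using solves f by (simp add: solves_gap_welfare_def)
  have "must_output_zero n m \<alpha> f"
    using n by (auto simp: must_output_zero_def \<alpha> w)
  hence zero: "prob {P \<in> space R. \<not> outcome P f} \<ge> 2 / 3"
    using solves f by (simp add: solves_gap_welfare_def)
  have "{P \<in> space R. outcome P f} \<in> events"
    using one measure_notin_sets[of "{P \<in> space R. outcome P f}" R] by force
  hence "prob (space R - {P \<in> space R. outcome P f}) = 1 - prob {P \<in> space R. outcome P f}"
    by (rule prob_compl)
  moreover have "space R - {P \<in> space R. outcome P f} = {P \<in> space R. \<not> outcome P f}" by auto
  ultimately have False using one zero by simp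
  thus "z \<le> real k" ..
qed

lemma log2_less_half: "x \<ge> 16 \<Longrightarrow> log 2 x < x / 2" for x :: real
proof -
  assume x: "x \<ge> 16"
  have "1 / 2 \<le> ln (2 :: real)" using ln_ge_iff[of 2 "1/2"] exp_half_le2 by simp
  have "ln (x / 16) \<le> x / 16 - 1" using x by (intro ln_le_minus_one) auto
  hence "log 2 (x / 16) \<le> (x / 16 - 1) / ln 2"
    unfolding log_def by (intro divide_right_mono) auto
  also have "\<dots> \<le> (x / 16 - 1) / (1 / 2)"
    using x \<open>1 / 2 \<le> ln 2\<close> by (intro divide_left_mono) auto
  finally have "log 2 (x / 16) \<le> x / 8 - 2" by simp
  moreover have "log 2 (x / 16) = log 2 x - 4"
  proof -
    have "log 2 (16 :: real) = log 2 (2 ^ 4)" by simp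
    also have "\<dots> = 4" by (subst log_nat_power) auto
    finally show ?thesis using x by (simp add: log_divide)
  qed
  ultimately show ?thesis using x by simp
qed

text \<open>\<open>r\<close> is chosen so that n^(2 r) is at most the fourth root of m; the 16 in
  \<open>large\<close> ensures r \<ge> 2.\<close>

locale large_market =
  fixes n m :: nat and r :: nat
  assumes n: "n \<ge> 2" and m: "m \<ge> 2" and large: "16 * log 2 n < log 2 m"
    and r: "r = nat \<lfloor>log 2 m / (8 * log 2 n)\<rfloor>"
begin

lemma log_n: "log 2 n \<ge> 1"
  using n by simp

lemma r_bounds: "r \<ge> 2" "r * (8 * log 2 n) \<le> log 2 m" "log 2 m < (real r + 1) * (8 * log 2 n)"
proof -
  define y where "y = log 2 m / (8 * log 2 n)"
  have y: "y \<ge> 2" using large log_n by (simp add: y_def field_simps)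
  hence "2 \<le> \<lfloor>y\<rfloor>" by (simp add: le_floor_iff)
  thus "r \<ge> 2" unfolding r y_def[symmetric] by linarith
  have "real r \<le> y" "y < real r + 1"
    unfolding r y_def[symmetric] using y by linarith+
  thus "r * (8 * log 2 n) \<le> log 2 m" "log 2 m < (real r + 1) * (8 * log 2 n)"
    using log_n by (simp_all add: y_def field_simps)
qed

text \<open>The unit of all estimates below: n^(2 r) and 4 r are at most \<open>x\<close>, while
  sqrt m is its square.\<close>

definition x :: real where
  "x = m powr (1 / 4)"

lemma x_pos: "x > 0"
  using m by (simp add: x_def)

lemma x_power: "x ^ 4 = m"
  using m by (simp add: x_def powr_realpow[symmetric] powr_powr)

lemma sqrt_m: "sqrt m = x\<^sup>2"
proof -
  have "(x\<^sup>2)\<^sup>2 = m" using x_power by simp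
  thus ?thesis by (simp add: real_sqrt_unique)
qed

lemma log_m: "log 2 m = 4 * log 2 x"
  using x_pos by (simp add: x_power[symmetric] log_nat_power)

lemma x_ge: "x \<ge> 16"
proof -
  have "log 2 x \<ge> 4" using large log_n log_m by simp
  hence "2 powr 4 \<le> x" using x_pos by (simp add: le_log_iff)
  thus ?thesis by simp
qed

lemma log_m_less: "log 2 m < 2 * x"
  using log2_less_half[OF x_ge] by (simp add: log_m)

lemma r_less: "4 * real r < x"
proof -
  have "real r * 8 \<le> r * (8 * log 2 n)" using log_n by (intro mult_left_mono) auto
  thus ?thesis using r_bounds(2) log_m_less by linarith
qed

lemma n_power: "real n ^ (2 * r) \<le> x"
proof -
  have "log 2 (real n ^ (2 * r)) = 2 * r * log 2 n"
    using n by (simp add: log_nat_power)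
  also have "\<dots> \<le> log 2 x" using r_bounds(2) log_m by simp
  finally show ?thesis using n x_pos by simp
qed

definition K :: nat where
  "K = 2 ^ nat \<lfloor>sqrt m\<rfloor>"

lemma K_bounds: "real K \<le> 2 powr x\<^sup>2" "2 powr x\<^sup>2 \<le> 2 * real K" "x\<^sup>2 < real K"
proof -
  define s where "s = nat \<lfloor>x\<^sup>2\<rfloor>"
  have "0 \<le> x\<^sup>2" by simp
  hence s: "real s \<le> x\<^sup>2" "x\<^sup>2 < real s + 1" unfolding s_def by linarith+
  have K: "K = 2 ^ s" by (simp add: K_def s_def sqrt_m)
  have "real K = 2 powr s" by (simp add: K powr_realpow)
  thus "real K \<le> 2 powr x\<^sup>2" using s by simp
  have "2 powr x\<^sup>2 \<le> 2 powr (real s + 1)" using s by simp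
  thus "2 powr x\<^sup>2 \<le> 2 * real K" by (simp add: powr_add \<open>real K = 2 powr s\<close>)
  have "Suc s \<le> K" using less_exp[of s] by (simp add: K Suc_le_eq)
  thus "x\<^sup>2 < real K" using s by linarith
qed

text \<open>There are at most exp (4 r x^2) prescriptions, each missed with probability at most exp
  (- m / n^(2 r)) \<le> exp (- x^3); the product is below 1 as 4 r < x.\<close>

lemma exists_universal: "\<exists>col. universal m n K (2 * r) col"
proof (rule universal_exists)
  have xx: "x \<le> x\<^sup>2" using x_ge by (simp add: power2_eq_square)
  show "2 * r \<le> K" using r_less K_bounds(3) xx by linarith
  show "1 \<le> n" using n by simp
  define N where "N = real n ^ (2 * r)"
  have N: "1 \<le> N" "N \<le> x" using n n_power by (auto simp: N_def)
  have "real n ^ 1 \<le> N"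
    unfolding N_def using n r_bounds(1) by (intro power_increasing) auto
  hence "real n \<le> N" by simp
  hence "real n \<le> exp (x\<^sup>2)"
    using N xx exp_ge_add_one_self[of "x\<^sup>2"] by linarith
  moreover have "real K \<le> exp (x\<^sup>2)"
  proof -
    have "real K \<le> 2 powr x\<^sup>2" by (rule K_bounds)
    also have "\<dots> \<le> exp 1 powr x\<^sup>2" using exp_ge_add_one_self[of 1] by (intro powr_mono2) auto
    finally show ?thesis by (simp add: powr_def)
  qed
  ultimately have "real K * real n \<le> exp (x\<^sup>2) * exp (x\<^sup>2)"
    by (intro mult_mono) auto
  hence "(real K * real n) ^ (2 * r) \<le> (exp (x\<^sup>2) * exp (x\<^sup>2)) ^ (2 * r)"
    by (intro power_mono) auto
  also have "\<dots> = exp (4 * real r * x\<^sup>2)"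
    by (simp add: exp_add[symmetric] exp_of_nat_mult[symmetric] algebra_simps)
  finally have A: "(real K * real n) ^ (2 * r) \<le> exp (4 * real r * x\<^sup>2)" .
  have "(1 - 1 / N) ^ m \<le> exp (- (1 / N)) ^ m"
    using N exp_ge_add_one_self[of "- (1 / N)"] by (intro power_mono) auto
  also have "\<dots> = exp (- (m / N))"
    by (simp add: exp_of_nat_mult[symmetric])
  also have "\<dots> \<le> exp (- (x ^ 3))"
  proof -
    have "x ^ 3 * N \<le> x ^ 3 * x" using N x_pos by (intro mult_left_mono) auto
    also have "x ^ 3 * x = x ^ 4" by (simp add: power3_eq_cube power4_eq_xxxx)
    also have "\<dots> = m" by (rule x_power)
    finally show ?thesis using N by (simp add: pos_le_divide_eq)
  qed
  finally have B: "(1 - 1 / N) ^ m \<le> exp (- (x ^ 3))" .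
  have "(real K * real n) ^ (2 * r) * (1 - 1 / N) ^ m \<le> exp (4 * real r * x\<^sup>2) * exp (- (x ^ 3))"
    using A B N by (intro mult_mono) auto
  also have "\<dots> = exp ((4 * real r - x) * x\<^sup>2)"
    by (simp add: exp_add[symmetric] algebra_simps power2_eq_square power3_eq_cube)
  also have "\<dots> < 1"
    using r_less x_pos by (simp add: mult_neg_pos)
  finally show "(real K * real n) ^ (2 * r) * (1 - 1 / real n ^ (2 * r)) ^ m < 1"
    by (simp add: N_def)
qed

text \<open>The factor polynomial in n and r is of order x^5, hence below x^16 = m^4, which the loss
  of n^2 log m in the exponent absorbs because n \<ge> 2.\<close>

lemma communication_bound:
  assumes "K \<le> 576 * (n\<^sup>2 * (r\<^sup>2 - r))\<^sup>2 * k"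
  shows "2 powr (sqrt m - (real n)\<^sup>2 * log 2 m) \<le> real k"
proof -
  have "n\<^sup>2 * (r\<^sup>2 - r) \<le> n\<^sup>2 * r\<^sup>2" by simp
  hence "(n\<^sup>2 * (r\<^sup>2 - r))\<^sup>2 \<le> (n\<^sup>2 * r\<^sup>2)\<^sup>2" by (rule power_mono) simp
  hence "K \<le> 576 * (n\<^sup>2 * r\<^sup>2)\<^sup>2 * k"
    using assms by (meson le_trans mult_le_mono1 mult_le_mono2)
  hence "real K \<le> real (576 * (n\<^sup>2 * r\<^sup>2)\<^sup>2 * k)" by (simp only: of_nat_le_iff)
  hence K: "real K \<le> 576 * (real n ^ 4 * real r ^ 4) * k" by (simp add: power_mult_distrib)
  have n4: "real n ^ 4 \<le> x"
  proof -
    have "real n ^ 4 \<le> real n ^ (2 * r)" using n r_bounds(1) by (intro power_increasing) auto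
    thus ?thesis using n_power by linarith
  qed
  have "(4 * real r) ^ 4 \<le> x ^ 4" using r_less by (intro power_mono) auto
  hence r4: "256 * real r ^ 4 \<le> x ^ 4" by (simp add: power_mult_distrib)
  have "2 powr x\<^sup>2 \<le> 2 * real K" by (rule K_bounds)
  \<comment> \<open>Twice 576 is at most 5 times 256.\<close>
  also have "\<dots> \<le> 5 * (real n ^ 4 * (256 * real r ^ 4)) * k"
  proof -
    have "0 \<le> (real n ^ 4 * real r ^ 4) * k" by simp
    thus ?thesis using K by linarith
  qed
  also have "\<dots> \<le> 5 * (x * x ^ 4) * k"
    using n4 r4 x_pos by (intro mult_right_mono mult_left_mono mult_mono) auto
  also have "\<dots> \<le> x * (x * x ^ 4) * k"
    using x_ge x_pos by (intro mult_right_mono) auto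
  also have "x * (x * x ^ 4) = x ^ 6"
    using power_Suc[of x 4] power_Suc[of x 5] by simp
  also have "x ^ 6 * k \<le> x ^ 16 * k"
    using x_ge by (intro mult_right_mono power_increasing) auto
  finally have main: "2 powr x\<^sup>2 \<le> x ^ 16 * k" .
  have "2\<^sup>2 \<le> (real n)\<^sup>2" using n by (intro power_mono) auto
  hence "4 * log 2 m \<le> (real n)\<^sup>2 * log 2 m" using m by (intro mult_right_mono) auto
  hence "16 * log 2 x \<le> (real n)\<^sup>2 * log 2 m" by (simp add: log_m)
  hence "2 powr (sqrt m - (real n)\<^sup>2 * log 2 m) \<le> 2 powr (x\<^sup>2 - 16 * log 2 x)"
    by (simp add: sqrt_m)
  also have "\<dots> = 2 powr x\<^sup>2 / 2 powr (16 * log 2 x)"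
    by (rule powr_diff)
  also have "2 powr (16 * log 2 x) = x ^ 16"
  proof -
    have "16 * log 2 x = log 2 (x ^ 16)" using x_pos by (simp add: log_nat_power)
    thus ?thesis using x_pos by simp
  qed
  also have "2 powr x\<^sup>2 / x ^ 16 \<le> real k"
    using main x_pos by (simp add: pos_divide_le_eq mult.commute)
  finally show ?thesis .
qed

lemma strongly_inapproximable:
  assumes \<alpha>1: "\<alpha> 1 = 1" and \<alpha>: "\<And>t. t \<ge> 2 \<Longrightarrow> \<alpha> t = (2 * real r - 1) / (real r + 1)"
  shows "strongly_inapproximable n m (subadditive_valuations m) \<alpha>
    (2 powr (sqrt m - (real n)\<^sup>2 * log 2 m))"
  unfolding strongly_inapproximable_def
proof (intro allI impI, elim conjE)
  fix k R assume R: "randomized_protocol n k R"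
    and solves: "solves_gap_welfare n m (subadditive_valuations m) \<alpha> R"
  obtain col where "universal m n K (2 * r) col" using exists_universal by blast
  then interpret word_valuation m n K r col
    using r_bounds(1) by unfold_locales
  have "n \<ge> 1" using n by simp
  thus "2 powr (sqrt m - (real n)\<^sup>2 * log 2 m) \<le> real k"
    using protocol_lower_bound[OF _ R solves \<alpha>1 \<alpha>] by (intro communication_bound) simp
qed

end

section \<open>Combination of the two parameter ranges\<close>

theorem theorem1p8:
  "\<exists>(C::real) (c::real) (\<epsilon> :: nat \<Rightarrow> nat \<Rightarrow> nat \<Rightarrow> real) (\<alpha> :: nat \<Rightarrow> nat \<Rightarrow> nat \<Rightarrow> real).
     C > 0 \<and> c > 0 \<and>
     (\<forall>(n::nat) (m::nat). n \<ge> 1 \<longrightarrow> m \<ge> 2 \<longrightarrow>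
        (\<forall>t\<in>{1..n}.
           \<alpha> n m t = 2 - of_bool (t = 1) - \<epsilon> n m t \<and>
           \<bar>\<epsilon> n m t\<bar> \<le> C * (log 2 (real n) / log 2 (real m)) \<and>
           \<alpha> n m t > 0) \<and>
        strongly_inapproximable n m (subadditive_valuations m) (\<alpha> n m)
          (2 powr (c * (sqrt (real m) - (real n)\<^sup>2 * log 2 (real m)))))"
proof -
  \<comment> \<open>For n = 1 the error term must vanish, and t / n = 1 is then exactly the required
    ratio.\<close>
  define small where "small n m \<longleftrightarrow> n < 2 \<or> log 2 (real m) \<le> 16 * log 2 (real n)" for n m :: nat
  define r where "r n m = nat \<lfloor>log 2 (real m) / (8 * log 2 (real n))\<rfloor>" for n m :: nat
  define \<alpha> :: "nat \<Rightarrow> nat \<Rightarrow> nat \<Rightarrow> real" where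
    "\<alpha> n m t = (if small n m then real t / real n
       else if t = 1 then 1 else (2 * real (r n m) - 1) / (real (r n m) + 1))" for n m t
  define \<epsilon> :: "nat \<Rightarrow> nat \<Rightarrow> nat \<Rightarrow> real" where
    "\<epsilon> n m t = 2 - of_bool (t = 1) - \<alpha> n m t" for n m t
  have large: "large_market n m (r n m)" if "m \<ge> 2" "\<not> small n m" for n m
    using that by unfold_locales (auto simp: small_def r_def)
  have inapprox: "strongly_inapproximable n m (subadditive_valuations m) (\<alpha> n m)
          (2 powr (1 * (sqrt (real m) - (real n)\<^sup>2 * log 2 (real m))))" if "n \<ge> 1" "m \<ge> 2" for n m
  proof (cases "small n m")
    case True
    thus ?thesis using that by (intro strongly_inapproximable_conflict) (auto simp: \<alpha>_def)
  next
    case False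
    show ?thesis
      unfolding mult_1
      by (rule large_market.strongly_inapproximable[OF large[OF \<open>m \<ge> 2\<close> False]])
        (use False in \<open>auto simp: \<alpha>_def\<close>)
  qed
  have bounds: "\<bar>\<epsilon> n m t\<bar> \<le> 32 * (log 2 (real n) / log 2 (real m)) \<and> \<alpha> n m t > 0"
    if n: "n \<ge> 1" and m: "m \<ge> 2" and t: "t \<in> {1..n}" for n m t
  proof -
    have logm: "log 2 m > 0" using m by simp
    have logn: "log 2 n \<ge> 0" using n by simp
    consider "n = 1" | "n \<ge> 2" "small n m" | "n \<ge> 2" "\<not> small n m" using n by linarith
    thus ?thesis
    proof cases
      case 1
      thus ?thesis using t by (simp add: \<epsilon>_def \<alpha>_def small_def)
    next
      case 2
      hence "log 2 m \<le> 16 * log 2 n" by (simp add: small_def)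
      \<comment> \<open>The constant 32 is twice the 16 in \<open>small\<close>; here the allowed
        error is at least 2, which permits the ratio t / n.\<close>
      hence two: "2 \<le> 32 * (log 2 (real n) / log 2 (real m))" using logm by (simp add: field_simps)
      have frac: "0 < real t / n" "real t / n \<le> 1" using t by auto
      have ind: "0 \<le> (of_bool (t = 1) :: real)" "of_bool (t = 1) \<le> (1 :: real)" by auto
      have "\<epsilon> n m t = 2 - of_bool (t = 1) - real t / n" "\<alpha> n m t = real t / n"
        using 2 by (simp_all add: \<epsilon>_def \<alpha>_def)
      thus ?thesis using two frac ind unfolding abs_le_iff by linarith
    next
      case 3
      interpret large_market n m "r n m" using large[OF m] 3 by simp
      have r0: "real (r n m) + 1 > 0" by simp
      show ?thesis
      proof (cases "t = 1")
        case True
        thus ?thesis using 3 logm logn by (simp add: \<epsilon>_def \<alpha>_def)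
      next
        case False
        hence \<alpha>: "\<alpha> n m t = (2 * real (r n m) - 1) / (real (r n m) + 1)"
          using 3 by (simp add: \<alpha>_def)
        \<comment> \<open>By the choice of r as a floor, r + 1 exceeds log m / (8 log n), so this
          error is below 24 log n / log m.\<close>
        have \<epsilon>: "\<epsilon> n m t = 3 / (real (r n m) + 1)"
          using False r0 by (simp add: \<epsilon>_def \<alpha> field_simps)
        have "3 * log 2 m \<le> (real (r n m) + 1) * (32 * log 2 n)"
        proof -
          have "0 \<le> (real (r n m) + 1) * log 2 n" using logn by simp
          thus ?thesis using r_bounds(3) by simp
        qed
        hence "\<epsilon> n m t \<le> 32 * (log 2 n / log 2 m)"
          using r0 logm by (simp add: \<epsilon> field_simps)
        moreover have "\<epsilon> n m t \<ge> 0" by (simp add: \<epsilon>)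
        moreover have "\<alpha> n m t > 0" using r_bounds(1) r0 by (simp add: \<alpha>)
        ultimately show ?thesis by simp
      qed
    qed
  qed
  show ?thesis
    by (rule exI[of _ 32], rule exI[of _ 1], rule exI[of _ \<epsilon>], rule exI[of _ \<alpha>])
      (use bounds inapprox in \<open>auto simp: \<epsilon>_def\<close>)
qed

end
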